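(* For every pair of integers $r,k \ge 3$, there exists $K = K(r,k) > 0$ such that the following holds for all $n \in \mathbb{N}$. Given an $r$-graph $G$ on $[n]$ with $|E(G)| = t n^{r-1}$ for some $t \ge 2k(r-1)$, there exists a $k$-graph $\mathcal{H}$ with vertex set $E(G)$, where each edge of $\mathcal{H}$ is (the edge set of) a copy of $C^r_k$ in $G$, such that (1) $d(\mathcal{H}) \ge K^{-1} t^{k-2} D^{k-1}$, and (2) $\Delta_j(\mathcal{H}) \le K t^{k-j-1} D^{k-j}$ for each $1 \le j \le k-1$, where $D = t^2 n^{r-4}$ if $r \ge 4$ and $D = t$ if $r = 3$.
   Context: An $r$-graph is a pair $(V,E)$ of finite sets with $E$ a family of $r$-element subsets of $V$. The $r$-uniform linear $k$-cycle $C^r_k$ is the $r$-graph on $k(r-1)$ vertices whose vertices can be ordered cyclically so that its $k$ edges are sets of $r$ consecutive vertices in this ordering and every two consecutive edges share exactly one vertex. For a hypergraph $\mathcal{H}$ and a set $\sigma$ of vertices, $\deg_{\mathcal{H}}(\sigma)$ is the number of edges of $\mathcal{H}$ containing $\sigma$; $\Delta_j(\mathcal{H})$ is the maximum of $\deg_{\mathcal{H}}(\sigma)$ over all $j$-element vertex sets $\sigma$. The average degree of a $k$-graph $\mathcal{H}$ is $d(\mathcal{H}) = k|E(\mathcal{H})|/|V(\mathcal{H})|$. *)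

theory Defs
  imports Complex_Main
begin

type_synonym 'a hypergraph = "'a set \<times> 'a set set"

abbreviation verts :: "'a hypergraph \<Rightarrow> 'a set" where
  "verts \<equiv> fst"

abbreviation edges :: "'a hypergraph \<Rightarrow> 'a set set" where
  "edges \<equiv> snd"

definition r_graph :: "nat \<Rightarrow> 'a hypergraph \<Rightarrow> bool" where
  "r_graph r G \<longleftrightarrow> finite (verts G) \<and> finite (edges G) \<and>
     (\<forall>e\<in>edges G. e \<subseteq> verts G \<and> card e = r)"

definition hypergraph_iso :: "'a hypergraph \<Rightarrow> 'b hypergraph \<Rightarrow> bool" where
  "hypergraph_iso F G \<longleftrightarrow>
     (\<exists>f. bij_betw f (verts F) (verts G) \<and> edges G = (\<lambda>e. f ` e) ` edges F)"

definition copy_in :: "'a hypergraph \<Rightarrow> 'b hypergraph \<Rightarrow> 'a hypergraph \<Rightarrow> bool" where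
  "copy_in C F G \<longleftrightarrow> verts C \<subseteq> verts G \<and> edges C \<subseteq> edges G \<and> hypergraph_iso F C"

(* The cyclically ordered vertices are 0, ..., k(r-1)-1; the i-th edge consists of the
   r consecutive vertices starting at i(r-1), so it meets the next edge exactly in
   (i+1)(r-1), taken modulo k(r-1). *)
definition linear_cycle :: "nat \<Rightarrow> nat \<Rightarrow> nat hypergraph" where
  "linear_cycle r k =
     ({..<k * (r - 1)},
      (\<lambda>i. (\<lambda>j. (i * (r - 1) + j) mod (k * (r - 1))) ` {..<r}) ` {..<k})"

definition degree :: "'a hypergraph \<Rightarrow> 'a set \<Rightarrow> nat" where
  "degree H \<sigma> = card {e \<in> edges H. \<sigma> \<subseteq> e}"

definition max_degree :: "nat \<Rightarrow> 'a hypergraph \<Rightarrow> nat" where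
  "max_degree j H = Max (degree H ` {\<sigma>. \<sigma> \<subseteq> verts H \<and> card \<sigma> = j})"

definition average_degree :: "nat \<Rightarrow> 'a hypergraph \<Rightarrow> real" where
  "average_degree k H = real k * real (card (edges H)) / real (card (verts H))"

end

theory Submission
  imports Defs "HOL-Library.FuncSet"
begin

text \<open>
  It suffices to find a weight on the linear cycles of \<open>G\<close> of total order \<open>|E(G)|\<close> that is spread
  out: the cycles containing \<open>j < k\<close> given edges have weight \<open>O((t D)\<^sup>1\<^sup>-\<^sup>j)\<close>, and a single cycle has
  weight \<open>O((t D)\<^sup>2\<^sup>-\<^sup>k / D)\<close>. Indeed, let \<open>H\<close> be a maximal family of cycles obeying the degree bounds. By
  maximality every cycle lies in \<open>H\<close> or contains a set of edges whose degree is nearly extremal, and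
  if \<open>H\<close> were small then these two kinds of cycles could not carry the whole weight.

  To construct the weight, first pass to half of the edges such that every pair of vertices covered
  by an edge has degree at least \<open>t n\<^sup>r\<^sup>-\<^sup>3\<close>. Triangulate a \<open>k\<close>-gon as a fan. A random cycle arises
  by choosing a random edge and two vertices of it as a side, then repeatedly a random edge through the
  current diagonal and a vertex of that edge as the apex of the next triangle, and finally a random
  edge of \<open>G\<close> through each side of the polygon. This process is reversible, so it may be started at
  any side. Hence each further prescribed vertex costs a factor \<open>1/t\<close> (a triple has degree at most
  \<open>n\<^sup>r\<^sup>-\<^sup>3\<close>) and each further prescribed edge costs a factor \<open>1/(t n\<^sup>r\<^sup>-\<^sup>3) \<le> 1/D\<close>; moreover \<open>j < k\<close> sides of
  a \<open>k\<close>-gon cover at least \<open>j + 1\<close> vertices. As \<open>t \<ge> 2k(r - 1)\<close>, each choice avoids the at most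
  \<open>k(r - 1)\<close> vertices used so far with probability at least \<open>1/2\<close>.
\<close>

subsection \<open>From spread weights to balanced families\<close>

text \<open>Union bound, with the weight \<open>\<mu>\<close> in place of a probability.\<close>

lemma sum_le_sum_cover:
  fixes \<mu> :: "'w \<Rightarrow> real"
  assumes fin: "finite \<Omega>" "finite I" and nonneg: "\<And>\<omega>. \<omega> \<in> \<Omega> \<Longrightarrow> 0 \<le> \<mu> \<omega>"
    and cover: "\<And>\<omega>. \<omega> \<in> \<Omega> \<Longrightarrow> \<exists>i\<in>I. R i \<omega>"
  shows "(\<Sum>\<omega>\<in>\<Omega>. \<mu> \<omega>) \<le> (\<Sum>i\<in>I. \<Sum>\<omega> | \<omega> \<in> \<Omega> \<and> R i \<omega>. \<mu> \<omega>)"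
proof -
  have "(\<Sum>\<omega>\<in>\<Omega>. \<mu> \<omega>) \<le> (\<Sum>\<omega>\<in>\<Omega>. \<Sum>i\<in>I. if R i \<omega> then \<mu> \<omega> else 0)"
  proof (rule sum_mono)
    fix \<omega> assume \<omega>: "\<omega> \<in> \<Omega>"
    then obtain i where i: "i \<in> I" "R i \<omega>" using cover by blast
    show "\<mu> \<omega> \<le> (\<Sum>i\<in>I. if R i \<omega> then \<mu> \<omega> else 0)"
      using member_le_sum[of i I "\<lambda>i. if R i \<omega> then \<mu> \<omega> else 0"] i \<omega> nonneg fin(2) by auto
  qed
  also have "\<dots> = (\<Sum>i\<in>I. \<Sum>\<omega>\<in>\<Omega>. if R i \<omega> then \<mu> \<omega> else 0)"
    by (rule sum.swap)
  also have "\<dots> = (\<Sum>i\<in>I. \<Sum>\<omega> | \<omega> \<in> \<Omega> \<and> R i \<omega>. \<mu> \<omega>)"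
    using fin(1) by (simp add: sum.inter_filter)
  finally show ?thesis .
qed

text \<open>For a largest family \<open>H\<close> obeying the bounds, each set
  \<open>\<phi> \<omega>\<close> is in \<open>H\<close> or contains a saturated \<sigma>. The
  threshold of \<sigma> is tuned so that the weight above \<sigma> is at most its degree in
  \<open>H\<close> times a constant multiple of the bound for one whole set. Each member of
  \<open>H\<close> has only \<open>2 ^ k\<close> subsets, so the total weight is at most a constant
  number of such units per member. In the application \<open>B\<close> is
  \<open>t * D\<close>.\<close>

lemma balanced_subfamily_of_spread_weight:
  fixes \<mu> :: "'w \<Rightarrow> real" and \<phi> :: "'w \<Rightarrow> 'e set" and c B C D K :: real
  assumes fin: "finite \<Omega>" "finite E" and "E \<noteq> {}"
    and sub: "\<And>\<omega>. \<omega> \<in> \<Omega> \<Longrightarrow> \<phi> \<omega> \<subseteq> E \<and> card (\<phi> \<omega>) = k"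
    and k: "2 \<le> k" and B: "1 \<le> B" and D: "1 \<le> D" and C: "0 < C"
    and nonneg: "\<And>\<omega>. \<omega> \<in> \<Omega> \<Longrightarrow> 0 \<le> \<mu> \<omega>"
    and total: "c * card E \<le> (\<Sum>\<omega>\<in>\<Omega>. \<mu> \<omega>)"
    and small: "\<And>\<sigma>. \<lbrakk>\<sigma> \<subseteq> E; 1 \<le> card \<sigma>; card \<sigma> \<le> k - 1\<rbrakk> \<Longrightarrow>
      (\<Sum>\<omega> | \<omega> \<in> \<Omega> \<and> \<sigma> \<subseteq> \<phi> \<omega>. \<mu> \<omega>) \<le> C / B ^ (card \<sigma> - 1)"
    and whole: "\<And>S. \<lbrakk>S \<subseteq> E; card S = k\<rbrakk> \<Longrightarrow>
      (\<Sum>\<omega> | \<omega> \<in> \<Omega> \<and> S \<subseteq> \<phi> \<omega>. \<mu> \<omega>) \<le> C / (B ^ (k - 2) * D)"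
    and K: "1 \<le> K" "C * (1 + 2 ^ (k + 1)) \<le> K * c"
  shows "\<exists>H \<subseteq> \<phi> ` \<Omega>. inverse K * B ^ (k - 2) * D \<le> real k * card H / card E \<and>
    (\<forall>\<sigma>\<subseteq>E. 1 \<le> card \<sigma> \<and> card \<sigma> \<le> k - 1 \<longrightarrow>
       real (card {S \<in> H. \<sigma> \<subseteq> S}) \<le> K * B ^ (k - 1 - card \<sigma>) * D)"
proof -
  define J where "J = {\<sigma>. \<sigma> \<subseteq> E \<and> 1 \<le> card \<sigma> \<and> card \<sigma> \<le> k - 1}"
  define thr where "thr \<sigma> = K * B ^ (k - 1 - card \<sigma>) * D" for \<sigma> :: "'e set"
  define dg where "dg H \<sigma> = real (card {S \<in> H. \<sigma> \<subseteq> S})" for H :: "'e set set" and \<sigma>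
  define ok where "ok H \<longleftrightarrow> H \<subseteq> \<phi> ` \<Omega> \<and> (\<forall>\<sigma>\<in>J. dg H \<sigma> \<le> thr \<sigma>)" for H
  have thr1: "1 \<le> thr \<sigma>" for \<sigma>
  proof -
    have "1 * 1 \<le> K * B ^ (k - 1 - card \<sigma>)"
      using K(1) B by (intro mult_mono) auto
    hence "1 * 1 \<le> (K * B ^ (k - 1 - card \<sigma>)) * D"
      using D by (intro mult_mono) auto
    thus ?thesis unfolding thr_def by simp
  qed
  have finJ: "finite J" unfolding J_def using fin(2) by auto
  have "ok {}" unfolding ok_def dg_def using thr1 by (auto intro: order.trans[OF _ thr1])
  moreover have "\<forall>H. ok H \<longrightarrow> card H < Suc (card (\<phi> ` \<Omega>))"
    unfolding ok_def using fin(1) by (auto simp: less_Suc_eq_le intro: card_mono)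
  ultimately have "\<exists>H. ok H \<and> (\<forall>H'. ok H' \<longrightarrow> card H' \<le> card H)"
    by (rule ex_has_greatest_nat)
  then obtain H where H: "ok H" and max: "\<And>H'. ok H' \<Longrightarrow> card H' \<le> card H"
    by (elim exE conjE) auto
  have Hsub: "H \<subseteq> \<phi> ` \<Omega>" and Hdg: "\<And>\<sigma>. \<sigma> \<in> J \<Longrightarrow> dg H \<sigma> \<le> thr \<sigma>"
    using H unfolding ok_def by auto
  have finH: "finite H" using Hsub fin(1) finite_subset by blast
  have HE: "S \<subseteq> E" "card S = k" if "S \<in> H" for S using that Hsub sub by auto
  \<comment> \<open>Half the threshold is enough to block: a degree is 0 or at least 1, so one more
    set at most doubles a positive degree, while a zero degree becomes 1, and every threshold is at
    least 1.\<close>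
  define Sat where "Sat = {\<sigma> \<in> J. thr \<sigma> \<le> 2 * dg H \<sigma>}"
  have finSat: "finite Sat" unfolding Sat_def using finJ by auto
  have blocked: "\<phi> \<omega> \<in> H \<or> (\<exists>\<sigma>\<in>Sat. \<sigma> \<subseteq> \<phi> \<omega>)" if \<omega>: "\<omega> \<in> \<Omega>" for \<omega>
  proof (rule ccontr)
    assume neg: "\<not> ?thesis"
    hence new: "\<phi> \<omega> \<notin> H" by blast
    have "ok (insert (\<phi> \<omega>) H)" unfolding ok_def
    proof (intro conjI ballI)
      show "insert (\<phi> \<omega>) H \<subseteq> \<phi> ` \<Omega>" using Hsub \<omega> by auto
      fix \<sigma> assume \<sigma>: "\<sigma> \<in> J"
      show "dg (insert (\<phi> \<omega>) H) \<sigma> \<le> thr \<sigma>"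
      proof (cases "\<sigma> \<subseteq> \<phi> \<omega>")
        case False
        hence "{S \<in> insert (\<phi> \<omega>) H. \<sigma> \<subseteq> S} = {S \<in> H. \<sigma> \<subseteq> S}" by auto
        thus ?thesis using Hdg[OF \<sigma>] unfolding dg_def by simp
      next
        case True
        hence "{S \<in> insert (\<phi> \<omega>) H. \<sigma> \<subseteq> S} = insert (\<phi> \<omega>) {S \<in> H. \<sigma> \<subseteq> S}" by auto
        hence eq: "dg (insert (\<phi> \<omega>) H) \<sigma> = dg H \<sigma> + 1"
          unfolding dg_def using new finH by simp
        have "2 * dg H \<sigma> < thr \<sigma>" using neg True \<sigma> unfolding Sat_def by force
        moreover have "dg H \<sigma> = 0 \<or> 1 \<le> dg H \<sigma>"
          unfolding dg_def by (cases "card {S \<in> H. \<sigma> \<subseteq> S}") auto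
        ultimately show ?thesis using eq thr1[of \<sigma>] by linarith
      qed
    qed
    from max[OF this] show False using new finH by simp
  qed
  have Bpos: "0 < B" using B by simp
  \<comment> \<open>\<open>Q\<close> is the bound for one set of size \<open>k\<close>. Since
    \<open>card \<sigma> - 1\<close> and \<open>k - 1 - card \<sigma>\<close> add up to
    \<open>k - 2\<close>, the bound for a smaller \<sigma> is a multiple of \<open>Q\<close> as
    well.\<close>
  define Q where "Q = C / (B ^ (k - 2) * D)"
  have Qpos: "0 < Q" unfolding Q_def using C Bpos D by (intro divide_pos_pos mult_pos_pos) auto
  have "c * card E \<le> (\<Sum>\<omega>\<in>\<Omega>. \<mu> \<omega>)" by (rule total)
  also have "\<dots> \<le> (\<Sum>S\<in>H \<union> Sat. \<Sum>\<omega> | \<omega> \<in> \<Omega> \<and> S \<subseteq> \<phi> \<omega>. \<mu> \<omega>)"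
  proof (rule sum_le_sum_cover)
    show "\<exists>S\<in>H \<union> Sat. S \<subseteq> \<phi> \<omega>" if "\<omega> \<in> \<Omega>" for \<omega>
      using blocked[OF that] by blast
  qed (use fin finH finSat nonneg in auto)
  also have "\<dots> = (\<Sum>S\<in>H. \<Sum>\<omega> | \<omega> \<in> \<Omega> \<and> S \<subseteq> \<phi> \<omega>. \<mu> \<omega>) + (\<Sum>\<sigma>\<in>Sat. \<Sum>\<omega> | \<omega> \<in> \<Omega> \<and> \<sigma> \<subseteq> \<phi> \<omega>. \<mu> \<omega>)"
  proof -
    have "H \<inter> Sat = {}" using HE(2) k unfolding Sat_def J_def by force
    thus ?thesis using finH finSat by (simp add: sum.union_disjoint)
  qed
  also have "\<dots> \<le> (\<Sum>S\<in>H. Q) + (\<Sum>\<sigma>\<in>Sat. 2 * dg H \<sigma> * Q)"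
  proof (intro add_mono sum_mono)
    fix S assume "S \<in> H"
    thus "(\<Sum>\<omega> | \<omega> \<in> \<Omega> \<and> S \<subseteq> \<phi> \<omega>. \<mu> \<omega>) \<le> Q"
      unfolding Q_def using HE by (intro whole) auto
  next
    fix \<sigma> assume \<sigma>: "\<sigma> \<in> Sat"
    hence \<sigma>J: "\<sigma> \<subseteq> E" "1 \<le> card \<sigma>" "card \<sigma> \<le> k - 1" unfolding Sat_def J_def by auto
    have e: "k - 2 = (card \<sigma> - 1) + (k - 1 - card \<sigma>)" using \<sigma>J by linarith
    have "(\<Sum>\<omega> | \<omega> \<in> \<Omega> \<and> \<sigma> \<subseteq> \<phi> \<omega>. \<mu> \<omega>) \<le> C / B ^ (card \<sigma> - 1)"
      by (rule small[OF \<sigma>J])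
    also have "\<dots> = (B ^ (k - 1 - card \<sigma>) * D) * Q"
      unfolding Q_def e power_add using Bpos D by (simp add: field_simps)
    also have "\<dots> \<le> thr \<sigma> * Q"
    proof -
      have "1 * (B ^ (k - 1 - card \<sigma>) * D) \<le> K * (B ^ (k - 1 - card \<sigma>) * D)"
        using K(1) Bpos D by (intro mult_right_mono) auto
      thus ?thesis unfolding thr_def using Qpos by (intro mult_right_mono[of _ _ Q]) (auto simp: mult.assoc)
    qed
    also have "\<dots> \<le> 2 * dg H \<sigma> * Q" using \<sigma> Qpos unfolding Sat_def by (intro mult_right_mono) auto
    finally show "(\<Sum>\<omega> | \<omega> \<in> \<Omega> \<and> \<sigma> \<subseteq> \<phi> \<omega>. \<mu> \<omega>) \<le> 2 * dg H \<sigma> * Q" .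
  qed
  \<comment> \<open>Over all subsets of \<open>E\<close> the double count becomes exact: a member of
    \<open>H\<close> is counted once for each of its \<open>2 ^ k\<close> subsets.\<close>
  also have "(\<Sum>\<sigma>\<in>Sat. 2 * dg H \<sigma> * Q) \<le> (\<Sum>\<sigma>\<in>Pow E. 2 * dg H \<sigma> * Q)"
    using fin(2) Qpos unfolding Sat_def J_def dg_def by (intro sum_mono2) auto
  also have "\<dots> = 2 * Q * (\<Sum>\<sigma>\<in>Pow E. dg H \<sigma>)"
    by (simp add: sum_distrib_left mult_ac)
  also have "(\<Sum>\<sigma>\<in>Pow E. dg H \<sigma>) = (\<Sum>S\<in>H. 2 ^ k)"
  proof -
    have "(\<Sum>\<sigma>\<in>Pow E. dg H \<sigma>) = (\<Sum>\<sigma>\<in>Pow E. \<Sum>S\<in>H. if \<sigma> \<subseteq> S then 1 else 0)"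
      unfolding dg_def using finH by (simp add: sum.If_cases Int_def)
    also have "\<dots> = (\<Sum>S\<in>H. \<Sum>\<sigma>\<in>Pow E. if \<sigma> \<subseteq> S then 1 else 0)" by (rule sum.swap)
    also have "\<dots> = (\<Sum>S\<in>H. 2 ^ k)"
    proof (rule sum.cong[OF refl])
      fix S assume S: "S \<in> H"
      have "(\<Sum>\<sigma>\<in>Pow E. if \<sigma> \<subseteq> S then 1 else (0::real)) = card {\<sigma>\<in>Pow E. \<sigma> \<subseteq> S}"
        using fin(2) by (simp add: sum.If_cases Int_def)
      also have "{\<sigma>\<in>Pow E. \<sigma> \<subseteq> S} = Pow S" using HE(1)[OF S] by auto
      also have "card (Pow S) = 2 ^ k" using HE[OF S] fin(2) by (simp add: card_Pow finite_subset)
      finally show "(\<Sum>\<sigma>\<in>Pow E. if \<sigma> \<subseteq> S then 1 else (0::real)) = 2 ^ k" by simp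
    qed
    finally show ?thesis .
  qed
  finally have cE: "c * card E \<le> card H * (Q * (1 + 2 ^ (k + 1)))"
    by (simp add: algebra_simps)
  have cardE: "0 < real (card E)" using \<open>E \<noteq> {}\<close> fin(2) by (simp add: card_gt_0_iff)
  have BD: "0 < B ^ (k - 2) * D" using Bpos D by simp
  have "card E * (B ^ (k - 2) * D) * c \<le> card H * (C * (1 + 2 ^ (k + 1)))"
    using cE BD unfolding Q_def by (simp add: field_simps)
  also have "\<dots> \<le> card H * (K * c)" using K(2) by (intro mult_left_mono) auto
  finally have "card E * (B ^ (k - 2) * D) * c \<le> (card H * K) * c" by (simp add: mult_ac)
  moreover have "0 < c"
  proof -
    have "0 < C * (1 + 2 ^ (k + 1))" using C by (simp add: add_pos_pos)
    hence "0 < K * c" using K(2) by linarith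
    thus ?thesis using K(1) by (simp add: zero_less_mult_iff)
  qed
  ultimately have "card E * (B ^ (k - 2) * D) \<le> card H * K" by simp
  also have "\<dots> \<le> (k * card H) * K"
    using k K(1) mult_right_mono[of 1 "real k" "real (card H)"] by (intro mult_right_mono) auto
  finally have "inverse K * B ^ (k - 2) * D \<le> real k * card H / card E"
    using K(1) cardE by (simp add: field_simps)
  moreover have "\<forall>\<sigma>\<subseteq>E. 1 \<le> card \<sigma> \<and> card \<sigma> \<le> k - 1 \<longrightarrow>
       real (card {S \<in> H. \<sigma> \<subseteq> S}) \<le> K * B ^ (k - 1 - card \<sigma>) * D"
    using Hdg unfolding J_def dg_def thr_def by auto
  ultimately show ?thesis using Hsub by blast
qed

subsection \<open>Pairs of large degree\<close>

text \<open>Degenerate pairs get degree 0, so sums may run over all vertices without a distinctness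
  condition. The value is real because it serves as a divisor.\<close>

definition pair_degree :: "'a set set \<Rightarrow> 'a \<Rightarrow> 'a \<Rightarrow> real" where
  "pair_degree E a b = real (card {e \<in> E. a \<noteq> b \<and> a \<in> e \<and> b \<in> e})"

definition triple_degree :: "'a set set \<Rightarrow> 'a \<Rightarrow> 'a \<Rightarrow> 'a \<Rightarrow> real" where
  "triple_degree E a b c = real (card {e \<in> E. distinct [a, b, c] \<and> {a, b, c} \<subseteq> e})"

lemma binomial_le_power: "n choose m \<le> n ^ m"
  by (cases "m \<le> n") (auto intro: binomial_le_pow simp: binomial_eq_0)

text \<open>An edge through three given vertices is determined by its other \<open>r - 3\<close>
  vertices.\<close>

lemma triple_degree_le:
  assumes "finite V" and E: "\<And>e. e \<in> E \<Longrightarrow> e \<subseteq> V \<and> card e = r"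
  shows "triple_degree E a b c \<le> real (card V) ^ (r - 3)"
proof (cases "distinct [a, b, c]")
  case False
  hence none: "{e \<in> E. distinct [a, b, c] \<and> {a, b, c} \<subseteq> e} = {}" by blast
  show ?thesis unfolding triple_degree_def none by simp
next
  case True
  let ?A = "{e \<in> E. distinct [a, b, c] \<and> {a, b, c} \<subseteq> e}"
  have "card ?A \<le> card {s. s \<subseteq> V \<and> card s = r - 3}"
  proof (rule card_inj_on_le[where f = "\<lambda>e. e - {a, b, c}"])
    show "inj_on (\<lambda>e. e - {a, b, c}) ?A"
      by (rule inj_on_inverseI[where g = "\<lambda>s. s \<union> {a, b, c}"]) auto
    show "(\<lambda>e. e - {a, b, c}) ` ?A \<subseteq> {s. s \<subseteq> V \<and> card s = r - 3}"
    proof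
      fix s assume "s \<in> (\<lambda>e. e - {a, b, c}) ` ?A"
      then obtain e where e: "e \<in> E" "{a, b, c} \<subseteq> e" "s = e - {a, b, c}" by blast
      have "card {a, b, c} = 3" using True by auto
      with e E[OF e(1)] show "s \<in> {s. s \<subseteq> V \<and> card s = r - 3}"
        by (auto simp: card_Diff_subset)
    qed
    show "finite {s. s \<subseteq> V \<and> card s = r - 3}" using assms(1) by simp
  qed
  also have "\<dots> \<le> card V ^ (r - 3)"
    using assms(1) by (simp add: n_subsets binomial_le_power)
  finally show ?thesis unfolding triple_degree_def by (metis of_nat_le_iff of_nat_power)
qed

text \<open>A subfamily maximising the number of edges minus \<open>s\<close> times the number of covered pairs
  cannot contain a pair of positive degree below \<open>s\<close>.\<close>
lemma exists_dense_pair_core: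
  fixes s :: real
  assumes finV: "finite V" and E: "\<And>e. e \<in> E \<Longrightarrow> e \<subseteq> V" and "0 \<le> s"
  shows "\<exists>F\<subseteq>E. real (card E) - s * real (card V choose 2) \<le> real (card F) \<and>
    (\<forall>a b. pair_degree F a b = 0 \<or> s \<le> pair_degree F a b)"
proof -
  define shadow where "shadow F = {p. p \<subseteq> V \<and> card p = 2 \<and> (\<exists>e\<in>F. p \<subseteq> e)}" for F
  define f where "f F = real (card F) - s * real (card (shadow F))" for F
  have finE: "finite E" using finV E by (meson Pow_iff finite_Pow_iff finite_subset subsetI)
  have fin_shadow: "finite (shadow F)" for F unfolding shadow_def using finV by auto
  obtain F where F: "F \<subseteq> E" and max: "\<And>F'. F' \<subseteq> E \<Longrightarrow> f F' \<le> f F"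
  proof -
    have "Max (f ` Pow E) \<in> f ` Pow E" using finE by (intro Max_in) auto
    then obtain F where "F \<subseteq> E" "f F = Max (f ` Pow E)" by auto
    thus ?thesis using finE by (intro that[of F]) auto
  qed
  have finF: "finite F" using F finE finite_subset by blast
  have "card (shadow E) \<le> card V choose 2"
    unfolding n_subsets[OF finV, symmetric] shadow_def using finV by (intro card_mono) auto
  hence "s * real (card (shadow E)) \<le> s * real (card V choose 2)"
    using \<open>0 \<le> s\<close> by (intro mult_left_mono) auto
  moreover have "0 \<le> s * real (card (shadow F))" using \<open>0 \<le> s\<close> by simp
  \<comment> \<open>Here \<open>F\<close> is compared with the whole of \<open>E\<close>, whose
    shadow contains at most all pairs.\<close>
  ultimately have "real (card E) - s * real (card V choose 2) \<le> real (card F)"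
    using max[OF order.refl] unfolding f_def by linarith
  moreover have "s \<le> pair_degree F a b" if nz: "pair_degree F a b \<noteq> 0" for a b
  proof -
    let ?R = "{e \<in> F. a \<noteq> b \<and> a \<in> e \<and> b \<in> e}"
    have "?R \<noteq> {}" using nz unfolding pair_degree_def by force
    then obtain e where e: "e \<in> F" "a \<noteq> b" "a \<in> e" "b \<in> e" by blast
    \<comment> \<open>Deleting all edges through the pair uncovers it, which gains at least
      \<open>s\<close>. By maximality the number of deleted edges must be at least that
      gain.\<close>
    have "shadow (F - ?R) \<subseteq> shadow F - {{a, b}}" unfolding shadow_def using e by auto
    hence "card (shadow (F - ?R)) \<le> card (shadow F - {{a, b}})"
      using fin_shadow by (intro card_mono) auto
    moreover have "{a, b} \<in> shadow F" unfolding shadow_def using e E F by auto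
    hence "card (shadow F - {{a, b}}) < card (shadow F)"
      by (rule card_Diff1_less[OF fin_shadow])
    ultimately have "real (card (shadow (F - ?R))) + 1 \<le> real (card (shadow F))" by linarith
    hence "s * (real (card (shadow (F - ?R))) + 1) \<le> s * real (card (shadow F))"
      using \<open>0 \<le> s\<close> by (intro mult_left_mono)
    moreover have "real (card (F - ?R)) = real (card F) - pair_degree F a b"
      unfolding pair_degree_def using finF by (subst card_Diff_subset) (auto intro!: of_nat_diff card_mono)
    moreover have "f (F - ?R) \<le> f F" using F by (intro max) auto
    ultimately show ?thesis unfolding f_def by (simp add: algebra_simps)
  qed
  ultimately show ?thesis using F by auto
qed

subsection \<open>Copies of linear cycles\<close>

text \<open>Edge \<open>e i\<close> is tested against all polygon vertices but only against earlier
  edges, so that edges can be chosen one at a time; \<open>m\<close> counts the edges chosen so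
  far.\<close>

definition cycle_config :: "nat \<Rightarrow> nat \<Rightarrow> (nat \<Rightarrow> 'a) \<Rightarrow> (nat \<Rightarrow> 'a set) \<Rightarrow> bool" where
  "cycle_config k m v e \<longleftrightarrow>
     (\<forall>i<m. e i \<inter> (v ` {..<k} \<union> (\<Union>l<i. e l)) = {v i, v (Suc i mod k)})"

text \<open>The vertices are numbered in blocks of length \<open>r - 1\<close>: block
  \<open>i\<close> starts with the polygon vertex \<open>v i\<close> and continues with the vertices
  of \<open>e i\<close> off its two ends, in any order \<open>h i\<close>. The last vertex of
  \<open>e i\<close> is then the first one of the next block.\<close>

lemma linear_cycle_copy:
  assumes r: "3 \<le> r" and k: "2 \<le> k" and inj: "inj_on v {..<k}"
    and e: "\<And>i. i < k \<Longrightarrow> e i \<in> E \<and> e i \<subseteq> V \<and> card (e i) = r"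
    and cfg: "cycle_config k k v e"
  shows "copy_in (\<Union>i<k. e i, e ` {..<k}) (linear_cycle r k) (V, E)"
proof -
  define m where "m = r - 1"
  have m: "2 \<le> m" "r = Suc m" using r unfolding m_def by auto
  define ends where "ends i = {v i, v (Suc i mod k)}" for i
  have meet: "e i \<inter> (v ` {..<k} \<union> (\<Union>l<i. e l)) = ends i" if "i < k" for i
    using cfg that unfolding cycle_config_def ends_def by blast
  have ends_sub: "ends i \<subseteq> e i" if "i < k" for i using meet[OF that] by blast
  have nxt: "Suc i mod k < k" "Suc i mod k \<noteq> i" if "i < k" for i
    using that k by (auto simp: mod_Suc)
  have card_ends: "card (ends i) = 2" if "i < k" for i
  proof -
    have "v i \<noteq> v (Suc i mod k)" using inj_onD[OF inj] nxt[OF that] that by fastforce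
    thus ?thesis unfolding ends_def by simp
  qed
  have "\<exists>h. bij_betw h {1..<m} (e i - ends i)" if "i < k" for i
  proof (rule finite_same_card_bij)
    have fin: "finite (e i)" using e[OF that] m by (metis card.infinite nat.distinct(1))
    thus "finite (e i - ends i)" by simp
    show "card {1..<m} = card (e i - ends i)"
      using e[OF that] card_ends[OF that] ends_sub[OF that] fin m
      by (simp add: card_Diff_subset finite_subset)
  qed simp
  then obtain h where h: "\<And>i. i < k \<Longrightarrow> bij_betw (h i) {1..<m} (e i - ends i)" by metis
  define f where "f x = (if x mod m = 0 then v (x div m) else h (x div m) (x mod m))" for x
  have f_eq: "f (i * m + j) = (if j = 0 then v i else h i j)" if "j < m" for i j
    unfolding f_def using that m by simp
  have h_in: "h i j \<in> e i - ends i" if "i < k" "0 < j" "j < m" for i j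
    using bij_betwE[OF h[OF that(1)]] that by auto
  have lt: "i * m + j < k * m" if "i < k" "j < m" for i j
  proof -
    have "i * m + j < Suc i * m" using that by simp
    also have "\<dots> \<le> k * m" using that by (intro mult_le_mono1) auto
    finally show ?thesis .
  qed
  have edge: "f ` ((\<lambda>j. (i * m + j) mod (k * m)) ` {..<r}) = e i" if i: "i < k" for i
  proof -
    have split: "{..<r} = insert 0 (insert m {1..<m})" using m by auto
    \<comment> \<open>Position \<open>m\<close> of block \<open>i\<close> is position 0 of the next
      block, cyclically.\<close>
    have last: "f ((i * m + m) mod (k * m)) = v (Suc i mod k)"
    proof -
      have "(i * m + m) mod (k * m) = (Suc i mod k) * m + 0"
        using mult_mod_left[of "Suc i" k m] by (simp add: add.commute)
      thus ?thesis using f_eq[of 0] m by simp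
    qed
    have first: "f ((i * m + 0) mod (k * m)) = v i"
      using lt[OF i, of 0] f_eq[of 0 i] m by simp
    have mid: "f ((i * m + j) mod (k * m)) = h i j" if "j \<in> {1..<m}" for j
      using lt[OF i, of j] f_eq[of j i] that by simp
    have "(\<lambda>j. f ((i * m + j) mod (k * m))) ` {1..<m} = h i ` {1..<m}"
      using mid by (rule image_cong[OF refl])
    also have "\<dots> = e i - ends i" using h[OF i] by (rule bij_betw_imp_surj_on)
    finally show ?thesis unfolding image_image split image_insert first last
      using ends_sub[OF i] unfolding ends_def by auto
  qed
  have "inj_on f {..<k * m}"
  proof (rule linorder_inj_onI')
    fix x y assume xy: "x \<in> {..<k * m}" "y \<in> {..<k * m}" "x < y"
    define i j i' j' where ij: "i = x div m" "j = x mod m" "i' = y div m" "j' = y mod m"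
    have x: "x = i * m + j" and y: "y = i' * m + j'" unfolding ij by simp_all
    have b: "i < k" "i' < k" "j < m" "j' < m" "i \<le> i'"
      using xy m unfolding ij by (auto simp: less_mult_imp_div_less intro: div_le_mono)
    have fx: "f x = (if j = 0 then v i else h i j)" "f y = (if j' = 0 then v i' else h i' j')"
      unfolding x y using b by (simp_all add: f_eq)
    \<comment> \<open>An inner vertex of an edge is never a polygon vertex, as the edge meets the
      polygon only in its ends.\<close>
    have off: "h a c \<noteq> v b" if "a < k" "b < k" "0 < c" "c < m" for a b c
      using h_in[OF that(1,3,4)] meet[OF that(1)] that(2) by blast
    show "f x \<noteq> f y"
    proof (cases "i = i'")
      case True
      hence "j < j'" using xy x y by simp
      thus ?thesis using fx True off[of i i j'] b bij_betw_imp_inj_on[OF h[OF b(1)]]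
        by (auto dest: inj_onD)
    next
      case False
      hence "i < i'" using b by simp
      \<comment> \<open>An inner vertex of the later edge cannot lie in an earlier one; this is
        where the condition on earlier edges enters.\<close>
      have "h i j \<noteq> h i' j'" if "0 < j" "0 < j'"
      proof
        assume eq: "h i j = h i' j'"
        have "h i j \<in> (\<Union>l<i'. e l)" using h_in[OF b(1) that(1) b(3)] \<open>i < i'\<close> by blast
        thus False using h_in[OF b(2) that(2) b(4)] meet[OF b(2)] unfolding eq by blast
      qed
      moreover have "v i \<noteq> v i'" using inj_onD[OF inj, of i i'] b False by auto
      moreover have "0 < j \<Longrightarrow> h i j \<noteq> v i'" "0 < j' \<Longrightarrow> h i' j' \<noteq> v i" using off b by auto
      ultimately show ?thesis unfolding fx by (cases "j = 0"; cases "j' = 0") auto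
    qed
  qed
  moreover have "f ` {..<k * m} = (\<Union>i<k. e i)"
  proof
    show "f ` {..<k * m} \<subseteq> (\<Union>i<k. e i)"
    proof
      fix z assume "z \<in> f ` {..<k * m}"
      then obtain x where x: "x < k * m" "z = f x" by auto
      have i: "x div m < k" using x by (simp add: less_mult_imp_div_less)
      have "z \<in> e (x div m)"
        using x h_in[OF i, of "x mod m"] ends_sub[OF i] m unfolding f_def ends_def by auto
      thus "z \<in> (\<Union>i<k. e i)" using i by blast
    qed
    show "(\<Union>i<k. e i) \<subseteq> f ` {..<k * m}"
    proof
      fix z assume "z \<in> (\<Union>i<k. e i)"
      then obtain i where i: "i < k" "z \<in> e i" by blast
      then obtain j where "z = f ((i * m + j) mod (k * m))" using edge[OF i(1)] by blast
      moreover have "(i * m + j) mod (k * m) < k * m" using k m by simp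
      ultimately show "z \<in> f ` {..<k * m}" by blast
    qed
  qed
  ultimately have bij: "bij_betw f {..<k * m} (\<Union>i<k. e i)" unfolding bij_betw_def by (rule conjI)
  define c where "c i = (\<lambda>j. (i * m + j) mod (k * m)) ` {..<r}" for i
  have "e ` {..<k} = (\<lambda>i. f ` c i) ` {..<k}"
    unfolding c_def by (rule image_cong[OF refl], rule edge[symmetric]) simp
  hence "e ` {..<k} = (\<lambda>d. f ` d) ` c ` {..<k}" unfolding image_image .
  with bij have "hypergraph_iso (linear_cycle r k) (\<Union>i<k. e i, e ` {..<k})"
    unfolding hypergraph_iso_def linear_cycle_def m_def[symmetric] c_def fst_conv snd_conv
    by (intro exI conjI)
  moreover have "(\<Union>i<k. e i) \<subseteq> V" "e ` {..<k} \<subseteq> E" using e by blast+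
  ultimately show ?thesis unfolding copy_in_def fst_conv snd_conv by (intro conjI)
qed

subsection \<open>Fan weights\<close>

lemma sum_PiE_lessThan_Suc:
  fixes F :: "(nat \<Rightarrow> 'b) \<Rightarrow> real"
  shows "(\<Sum>v\<in>PiE {..<Suc m} A. F v) = (\<Sum>v\<in>PiE {..<m} A. \<Sum>x\<in>A m. F (v(m := x)))"
proof -
  have inj: "inj_on (\<lambda>(y, g). g(m := y)) (A m \<times> PiE {..<m} A)"
    by (rule inj_combinator) simp
  have "(\<Sum>v\<in>PiE {..<Suc m} A. F v) = (\<Sum>(x, v)\<in>A m \<times> PiE {..<m} A. F (v(m := x)))"
    unfolding lessThan_Suc PiE_insert_eq sum.reindex[OF inj] by (simp add: comp_def case_prod_unfold)
  also have "\<dots> = (\<Sum>x\<in>A m. \<Sum>v\<in>PiE {..<m} A. F (v(m := x)))"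
    by (rule sum.cartesian_product[symmetric])
  also have "\<dots> = (\<Sum>v\<in>PiE {..<m} A. \<Sum>x\<in>A m. F (v(m := x)))"
    by (rule sum.swap)
  finally show ?thesis .
qed

lemma sum_le_single_index:
  fixes c :: real
  assumes "finite A" "0 \<le> c"
  shows "(\<Sum>x\<in>A. if x = b then c else 0) \<le> c"
  using assms by (simp add: sum.delta)

lemma sum_split_by_value:
  fixes F :: "'b \<Rightarrow> 'c \<Rightarrow> real"
  assumes "finite A" "\<And>v. v \<in> P \<Longrightarrow> f v \<in> A"
  shows "(\<Sum>v\<in>P. F v (f v)) = (\<Sum>y\<in>A. \<Sum>v\<in>P. if f v = y then F v y else 0)"
proof -
  have "(\<Sum>v\<in>P. F v (f v)) = (\<Sum>v\<in>P. \<Sum>y\<in>A. if f v = y then F v y else 0)"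
    using assms by (intro sum.cong) (auto simp: sum.delta')
  also have "\<dots> = (\<Sum>y\<in>A. \<Sum>v\<in>P. if f v = y then F v y else 0)" by (rule sum.swap)
  finally show ?thesis .
qed

text \<open>A nonempty set closed under the cyclic successor is everything. For polygons: a nonempty
  set of sides, not all of them, covers more vertices than it has sides.\<close>

lemma card_less_card_Un_cyclic_Suc:
  assumes I: "I \<subseteq> {..<k}" "I \<noteq> {}" "card I < k"
  shows "card I < card (I \<union> (\<lambda>i. Suc i mod k) ` I)"
proof -
  have "\<not> (\<lambda>i. Suc i mod k) ` I \<subseteq> I"
  proof
    assume closed: "(\<lambda>i. Suc i mod k) ` I \<subseteq> I"
    obtain i where i: "i \<in> I" using I by blast
    have shift: "(i + d) mod k \<in> I" for d
    proof (induction d)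
      case 0
      then show ?case using i I by auto
    next
      case (Suc d)
      have "Suc ((i + d) mod k) mod k \<in> I" using closed Suc by blast
      thus ?case by (simp add: mod_Suc_eq)
    qed
    have "j \<in> I" if "j < k" for j
    proof -
      have "i + (k - i + j) = k + j" using i I by auto
      hence "(i + (k - i + j)) mod k = j" using that by simp
      thus ?thesis using shift by metis
    qed
    hence "{..<k} \<subseteq> I" by auto
    hence "card {..<k} \<le> card I" using I(1) finite_subset by (intro card_mono) auto
    thus False using I(3) by simp
  qed
  hence "I \<subset> I \<union> (\<lambda>i. Suc i mod k) ` I" by blast
  thus ?thesis using I(1) finite_subset by (intro psubset_card_mono) auto
qed

text \<open>In the application \<open>N\<close> is \<open>n ^ (r - 3)\<close>. The two degree bounds
  together say that a given third vertex lies in at most a fraction \<open>1 / t\<close> of the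
  edges through a covered pair.\<close>

locale dense_pairs =
  fixes V :: "'a set" and E :: "'a set set" and r :: nat and N t :: real
  assumes finite_V: "finite V"
    and edge: "\<And>e. e \<in> E \<Longrightarrow> e \<subseteq> V \<and> card e = r"
    and r3: "3 \<le> r" and N_pos: "0 < N" and t_pos: "0 < t"
    and triple_le: "\<And>a b c. triple_degree E a b c \<le> N"
    and pair_ge: "\<And>a b. pair_degree E a b = 0 \<or> t * N \<le> pair_degree E a b"
begin

abbreviation "p \<equiv> pair_degree E"
abbreviation "T \<equiv> triple_degree E"

lemma finite_E: "finite E"
  using finite_V edge by (meson Pow_iff finite_Pow_iff finite_subset subsetI)

lemma p_nonneg [simp]: "0 \<le> p a b" and T_nonneg [simp]: "0 \<le> T a b c"
  unfolding pair_degree_def triple_degree_def by simp_all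

lemma p_commute: "p a b = p b a"
  unfolding pair_degree_def by (rule arg_cong[where f = "\<lambda>A. real (card A)"]) blast

lemma T_swap12: "T a b c = T b a c"
  unfolding triple_degree_def by (rule arg_cong[where f = "\<lambda>A. real (card A)"]) auto

lemma T_swap23: "T a b c = T a c b"
  unfolding triple_degree_def by (rule arg_cong[where f = "\<lambda>A. real (card A)"]) auto

lemma T_eq_0: assumes "p a b = 0" shows "T a b c = 0"
proof -
  have "{e \<in> E. a \<noteq> b \<and> a \<in> e \<and> b \<in> e} = {}"
    using assms finite_E unfolding pair_degree_def by simp
  hence none: "{e \<in> E. distinct [a, b, c] \<and> {a, b, c} \<subseteq> e} = {}" by auto
  show ?thesis unfolding triple_degree_def none by simp
qed

text \<open>Double counting: each edge through the pair has \<open>r - 2\<close> further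
  vertices.\<close>

lemma sum_T: "(\<Sum>x\<in>V. T a b x) = real (r - 2) * p a b"
proof -
  have "(\<Sum>x\<in>V. T a b x) = (\<Sum>x\<in>V. \<Sum>e\<in>E. if distinct [a, b, x] \<and> {a, b, x} \<subseteq> e then 1 else 0)"
    unfolding triple_degree_def using finite_E by (simp add: sum.If_cases Int_def)
  also have "\<dots> = (\<Sum>e\<in>E. \<Sum>x\<in>V. if distinct [a, b, x] \<and> {a, b, x} \<subseteq> e then 1 else 0)"
    by (rule sum.swap)
  also have "\<dots> = (\<Sum>e\<in>E. if a \<noteq> b \<and> a \<in> e \<and> b \<in> e then real (r - 2) else 0)"
  proof (rule sum.cong[OF refl])
    fix e assume e: "e \<in> E"
    have "(\<Sum>x\<in>V. if distinct [a, b, x] \<and> {a, b, x} \<subseteq> e then 1 else (0::real)) =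
        real (card {x \<in> V. distinct [a, b, x] \<and> {a, b, x} \<subseteq> e})"
      using finite_V by (simp add: sum.If_cases Int_def)
    also have "\<dots> = (if a \<noteq> b \<and> a \<in> e \<and> b \<in> e then real (r - 2) else 0)"
    proof (cases "a \<noteq> b \<and> a \<in> e \<and> b \<in> e")
      case True
      hence "{x \<in> V. distinct [a, b, x] \<and> {a, b, x} \<subseteq> e} = e - {a, b}" using edge[OF e] by auto
      moreover have "card (e - {a, b}) = r - 2"
        using True edge[OF e] by (simp add: card_Diff_subset)
      ultimately show ?thesis using True by simp
    next
      case False
      hence "{x \<in> V. distinct [a, b, x] \<and> {a, b, x} \<subseteq> e} = {}" by auto
      thus ?thesis using False by (simp only: card.empty if_False of_nat_0)
    qed
    finally show "(\<Sum>x\<in>V. if distinct [a, b, x] \<and> {a, b, x} \<subseteq> e then 1 else (0::real)) =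
      (if a \<noteq> b \<and> a \<in> e \<and> b \<in> e then real (r - 2) else 0)" .
  qed
  also have "\<dots> = real (r - 2) * p a b"
    unfolding pair_degree_def using finite_E by (simp add: sum.If_cases Int_def)
  finally show ?thesis .
qed

lemma sum_T_le: "(\<Sum>x\<in>V. T a b x) \<le> real r * p a b"
  unfolding sum_T by (intro mult_right_mono) auto

lemma sum_T_ge: "p a b \<le> (\<Sum>x\<in>V. T a b x)"
  unfolding sum_T using r3 mult_right_mono[of 1 "real (r - 2)" "p a b"] by simp

text \<open>This is the price of a prescribed vertex: if the apex must lie in a given edge, each of
  its at most \<open>r\<close> candidates has triple degree at most \<open>N\<close>, which is at
  most \<open>p a b / t\<close> for a covered pair.\<close>

lemma sum_T_le_small:
  assumes "card A \<le> r"
  shows "(\<Sum>x\<in>A. T a b x) \<le> real r / t * p a b"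
proof (cases "p a b = 0")
  case True
  then show ?thesis by (simp add: T_eq_0)
next
  case False
  have "(\<Sum>x\<in>A. T a b x) \<le> real (card A) * N"
    using triple_le by (intro sum_bounded_above)
  also have "\<dots> \<le> real r * N" using assms N_pos by (intro mult_right_mono) auto
  also have "\<dots> = real r / t * (t * N)" using t_pos by simp
  also have "\<dots> \<le> real r / t * p a b" using pair_ge[of a b] False t_pos by (intro mult_left_mono) auto
  finally show ?thesis .
qed

text \<open>Weight of the vertices \<open>v 0, \<dots>, v (n + 1)\<close> of a polygon triangulated from \<open>v 0\<close>: the product
  of the degrees of the \<open>n\<close> triangles over the product of the degrees of the inner diagonals.
  Although built up from the side \<open>v 0, v 1\<close>, it can be read as a chain of conditional
  distributions starting at any side of the polygon. Division by a vanishing degree is harmless,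
  as the degree of the triangle then vanishes too.\<close>
primrec fan :: "nat \<Rightarrow> (nat \<Rightarrow> 'a) \<Rightarrow> real" where
  "fan 0 v = p (v 0) (v 1)"
| "fan (Suc n) v = fan n v * T (v 0) (v (Suc n)) (v (n + 2)) / p (v 0) (v (Suc n))"

lemma fan_nonneg [simp]: "0 \<le> fan n v"
  by (induction n) auto

lemma fan_cong: "(\<And>i. i < n + 2 \<Longrightarrow> v i = w i) \<Longrightarrow> fan n v = fan n w"
  by (induction n) auto

lemma fan_upd [simp]: "fan n (v(Suc (Suc n) := x)) = fan n v"
  by (rule fan_cong) auto

text \<open>A nonzero last triangle has three covered pairs: the diagonal it is glued to and the two
  new sides. The case \<open>n = 0\<close> is a digon, whose single pair serves as both
  sides.\<close>

lemma fan_sides_nonzero: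
  "fan n v \<noteq> 0 \<Longrightarrow> i < n + 2 \<Longrightarrow> p (v i) (v (Suc i mod (n + 2))) \<noteq> 0"
proof (induction n arbitrary: i)
  case 0
  hence "i = 0 \<or> i = 1" by auto
  then show ?case using 0(1) p_commute[of "v 0" "v 1"] by auto
next
  case (Suc n)
  have nz: "fan n v \<noteq> 0" "T (v 0) (v (Suc n)) (v (n + 2)) \<noteq> 0" using Suc.prems(1) by auto
  have side2: "p (v (Suc n)) (v (n + 2)) \<noteq> 0"
    using nz(2) T_eq_0 T_swap12 T_swap23 by metis
  have side3: "p (v (n + 2)) (v 0) \<noteq> 0"
    using nz(2) T_eq_0 T_swap12 T_swap23 by metis
  consider "i < Suc n" | "i = Suc n" | "i = n + 2" using Suc.prems(2) by linarith
  then show ?case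
  proof cases
    case 1
    then show ?thesis using Suc.IH[OF nz(1), of i] by (simp add: mod_Suc)
  next
    case 2
    then show ?thesis using side2 by simp
  next
    case 3
    then show ?thesis using side3 by simp
  qed
qed

text \<open>This is the reversibility of the fan. With the ends of any one side fixed, every other
  vertex \<open>l\<close> costs its own factor \<open>m l\<close>. The induction removes the last
  triangle; if the fixed side belongs to it, the chain is read from that side across the triangle
  into the smaller polygon.\<close>

lemma fan_box_le:
  assumes fin: "\<And>l. l < n + 2 \<Longrightarrow> finite (A l)" and m: "\<And>l. 0 \<le> m l"
    and bnd: "\<And>l a b. l < n + 2 \<Longrightarrow> (\<Sum>x\<in>A l. T a b x) \<le> m l * p a b"
    and "i < n + 2"
  shows "(\<Sum>v\<in>PiE {..<n + 2} A. if v i = a \<and> v (Suc i mod (n + 2)) = b then fan n v else 0)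
    \<le> p a b * prod m ({..<n + 2} - {i, Suc i mod (n + 2)})"
  using assms
proof (induction n arbitrary: i a b)
  case 0
  have eq: "(\<Sum>v\<in>PiE {..<2} A. F (v 0) (v 1)) = (\<Sum>x\<in>A 0. \<Sum>y\<in>A 1. F x y)"
    for F :: "'a \<Rightarrow> 'a \<Rightarrow> real"
    unfolding numeral_2_eq_2 sum_PiE_lessThan_Suc by (simp add: PiE_empty_domain)
  have le: "(\<Sum>x\<in>A 0. \<Sum>y\<in>A 1. if x = a \<and> y = b then p x y else 0) \<le> p a b" for a b
  proof -
    have "(\<Sum>x\<in>A 0. \<Sum>y\<in>A 1. if x = a \<and> y = b then p x y else 0)
        = (\<Sum>x\<in>A 0. if x = a then \<Sum>y\<in>A 1. if y = b then p a b else 0 else 0)"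
      by (intro sum.cong) (auto intro!: sum.cong)
    also have "\<dots> \<le> (\<Sum>y\<in>A 1. if y = b then p a b else 0)"
      using 0 by (intro sum_le_single_index sum_nonneg) auto
    also have "\<dots> \<le> p a b" using 0 by (intro sum_le_single_index) auto
    finally show ?thesis .
  qed
  consider "i = 0" | "i = 1" using 0(4) by linarith
  then show ?case
  proof cases
    case 1
    have empty: "{..<0 + 2} - {0, Suc 0 mod (0 + 2)} = {}" by auto
    show ?thesis using le[of a b] eq[of "\<lambda>x y. if x = a \<and> y = b then p x y else 0"]
      unfolding 1 empty by (simp add: numeral_2_eq_2 cong: if_cong)
  next
    case 2
    have empty: "{..<0 + 2} - {1, Suc 1 mod (0 + 2)} = {}" by auto
    show ?thesis using le[of b a] eq[of "\<lambda>x y. if x = b \<and> y = a then p x y else 0"]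
      unfolding 2 empty by (simp add: numeral_2_eq_2 p_commute[of a b] conj_commute cong: if_cong)
  qed
next
  case (Suc n)
  let ?k = "n + 2"
  let ?P = "PiE {..<?k} A"
  have IH: "(\<Sum>v\<in>?P. if v i = a \<and> v (Suc i mod ?k) = b then fan n v else 0)
    \<le> p a b * prod m ({..<?k} - {i, Suc i mod ?k})" if "i < ?k" for i a b
    using Suc.prems that by (intro Suc.IH) auto
  have last: "Suc (Suc n) mod ?k = 0" by simp
  \<comment> \<open>The diagonal carrying the last triangle is the closing side of the smaller
    polygon. With its ends fixed, the induction hypothesis gives the factor \<open>p\<close> that
    cancels the division in \<open>fan\<close>.\<close>
  define R where "R = prod m ({..<?k} - {Suc n, 0})"
  have R0: "0 \<le> R" unfolding R_def using m by (intro prod_nonneg) auto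
  have close: "(\<Sum>v\<in>?P. if v (Suc n) = a \<and> v 0 = b then fan n v else 0) \<le> p a b * R" for a b
    using IH[of "Suc n" a b] unfolding last R_def by simp
  have fins: "finite (A l)" if "l \<le> ?k" for l using Suc.prems(1) that by simp
  have bnd': "(\<Sum>x\<in>A l. T a b x) \<le> m l * p a b" if "l \<le> ?k" for l a b
    using Suc.prems(3) that by simp
  let ?g = "\<lambda>v x. fan n v * T (v 0) (v (Suc n)) x / p (v 0) (v (Suc n))"
  have step: "fan (Suc n) (v(?k := x)) = ?g v x" for v x by simp
  have k3: "Suc n + 2 = Suc ?k" by simp
  have expand: "(\<Sum>v\<in>PiE {..<Suc n + 2} A.
      if v i = a \<and> v (Suc i mod (Suc n + 2)) = b then fan (Suc n) v else 0)
    = (\<Sum>v\<in>?P. \<Sum>x\<in>A ?k. if (v(?k := x)) i = a \<and> (v(?k := x)) (Suc i mod (Suc n + 2)) = b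
        then ?g v x else 0)"
    unfolding k3 sum_PiE_lessThan_Suc step by (rule refl)
  consider "i < Suc n" | "i = Suc n" | "i = ?k" using Suc.prems(4) by linarith
  then show ?case
  proof cases
    case 1
    \<comment> \<open>The fixed side belongs to the smaller polygon: the new apex is summed out
      first, at cost \<open>m ?k\<close>.\<close>
    have nxt: "Suc i mod (Suc n + 2) = Suc i" "Suc i mod ?k = Suc i" using 1 by auto
    have "(\<Sum>v\<in>?P. \<Sum>x\<in>A ?k. if (v(?k := x)) i = a \<and> (v(?k := x)) (Suc i mod (Suc n + 2)) = b
        then ?g v x else 0)
      \<le> (\<Sum>v\<in>?P. m ?k * (if v i = a \<and> v (Suc i) = b then fan n v else 0))"
    proof (rule sum_mono)
      fix v
      have "(\<Sum>x\<in>A ?k. ?g v x) = fan n v / p (v 0) (v (Suc n)) * (\<Sum>x\<in>A ?k. T (v 0) (v (Suc n)) x)"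
        by (simp add: sum_distrib_left)
      also have "\<dots> \<le> fan n v / p (v 0) (v (Suc n)) * (m ?k * p (v 0) (v (Suc n)))"
        by (intro mult_left_mono bnd') auto
      also have "\<dots> \<le> m ?k * fan n v" using m[of ?k] by (cases "p (v 0) (v (Suc n)) = 0") auto
      finally show "(\<Sum>x\<in>A ?k. if (v(?k := x)) i = a \<and> (v(?k := x)) (Suc i mod (Suc n + 2)) = b
        then ?g v x else 0) \<le> m ?k * (if v i = a \<and> v (Suc i) = b then fan n v else 0)"
        unfolding nxt using 1 by (cases "v i = a \<and> v (Suc i) = b") auto
    qed
    also have "\<dots> = m ?k * (\<Sum>v\<in>?P. if v i = a \<and> v (Suc i) = b then fan n v else 0)"
      by (rule sum_distrib_left[symmetric])
    also have "\<dots> \<le> m ?k * (p a b * prod m ({..<?k} - {i, Suc i}))"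
      using IH[of i a b] m 1 unfolding nxt by (intro mult_left_mono) auto
    also have "\<dots> = p a b * prod m (insert ?k ({..<?k} - {i, Suc i}))" by simp
    also have "insert ?k ({..<?k} - {i, Suc i}) = {..<Suc n + 2} - {i, Suc i}" using 1 by auto
    finally show ?thesis unfolding expand unfolding nxt .
  next
    case 2
    \<comment> \<open>The fixed side runs from \<open>v (Suc n)\<close> to the new apex. The third
      vertex \<open>y = v 0\<close> of the triangle is summed last and costs
      \<open>m 0\<close>.\<close>
    have nxt: "Suc i mod (Suc n + 2) = ?k" using 2 by simp
    have "(\<Sum>v\<in>?P. \<Sum>x\<in>A ?k. if (v(?k := x)) i = a \<and> (v(?k := x)) (Suc i mod (Suc n + 2)) = b
        then ?g v x else 0)
      \<le> (\<Sum>v\<in>?P. if v (Suc n) = a then fan n v * T (v 0) a b / p (v 0) a else 0)"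
    proof (rule sum_mono)
      fix v
      show "(\<Sum>x\<in>A ?k. if (v(?k := x)) i = a \<and> (v(?k := x)) (Suc i mod (Suc n + 2)) = b
        then ?g v x else 0) \<le> (if v (Suc n) = a then fan n v * T (v 0) a b / p (v 0) a else 0)"
      proof (cases "v (Suc n) = a")
        case True
        have "(\<Sum>x\<in>A ?k. if (v(?k := x)) i = a \<and> (v(?k := x)) (Suc i mod (Suc n + 2)) = b
          then ?g v x else 0) = (\<Sum>x\<in>A ?k. if x = b then ?g v b else 0)"
          unfolding nxt unfolding 2 using True by (intro sum.cong) auto
        also have "\<dots> \<le> ?g v b" using fins by (intro sum_le_single_index) auto
        finally show ?thesis using True by simp
      qed (use nxt 2 in simp)
    qed
    also have "\<dots> = (\<Sum>y\<in>A 0. \<Sum>v\<in>?P. if v 0 = y then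
        (if v (Suc n) = a then fan n v * T y a b / p y a else 0) else 0)"
      using fins by (intro sum_split_by_value) auto
    also have "\<dots> = (\<Sum>y\<in>A 0. T y a b / p y a *
        (\<Sum>v\<in>?P. if v (Suc n) = a \<and> v 0 = y then fan n v else 0))"
      unfolding sum_distrib_left by (intro sum.cong) auto
    also have "\<dots> \<le> (\<Sum>y\<in>A 0. T y a b / p y a * (p a y * R))"
      by (intro sum_mono mult_left_mono close) auto
    also have "\<dots> \<le> (\<Sum>y\<in>A 0. T a b y * R)"
    proof (rule sum_mono)
      fix y
      have "T y a b = T a b y" using T_swap12 T_swap23 by metis
      thus "T y a b / p y a * (p a y * R) \<le> T a b y * R"
        using R0 p_commute[of a y] by (cases "p y a = 0") auto
    qed
    also have "\<dots> = (\<Sum>y\<in>A 0. T a b y) * R" by (rule sum_distrib_right[symmetric])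
    also have "\<dots> \<le> (m 0 * p a b) * R" using R0 by (intro mult_right_mono bnd') auto
    also have "\<dots> = p a b * prod m (insert 0 ({..<?k} - {Suc n, 0}))"
      unfolding R_def by simp
    also have "insert 0 ({..<?k} - {Suc n, 0}) = {..<Suc n + 2} - {Suc n, ?k}" by auto
    finally show ?thesis unfolding expand unfolding nxt unfolding 2 .
  next
    case 3
    \<comment> \<open>The fixed side runs from the new apex to \<open>v 0\<close>; now
      \<open>y = v (Suc n)\<close> is the third vertex of the triangle.\<close>
    have nxt: "Suc i mod (Suc n + 2) = 0" using 3 by simp
    have "(\<Sum>v\<in>?P. \<Sum>x\<in>A ?k. if (v(?k := x)) i = a \<and> (v(?k := x)) (Suc i mod (Suc n + 2)) = b
        then ?g v x else 0)
      \<le> (\<Sum>v\<in>?P. if v 0 = b then fan n v * T b (v (Suc n)) a / p b (v (Suc n)) else 0)"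
    proof (rule sum_mono)
      fix v
      show "(\<Sum>x\<in>A ?k. if (v(?k := x)) i = a \<and> (v(?k := x)) (Suc i mod (Suc n + 2)) = b
        then ?g v x else 0) \<le> (if v 0 = b then fan n v * T b (v (Suc n)) a / p b (v (Suc n)) else 0)"
      proof (cases "v 0 = b")
        case True
        have "(\<Sum>x\<in>A ?k. if (v(?k := x)) i = a \<and> (v(?k := x)) (Suc i mod (Suc n + 2)) = b
          then ?g v x else 0) = (\<Sum>x\<in>A ?k. if x = a then ?g v a else 0)"
          unfolding nxt unfolding 3 using True by (intro sum.cong) auto
        also have "\<dots> \<le> ?g v a" using fins by (intro sum_le_single_index) auto
        finally show ?thesis using True by simp
      qed (use nxt 3 in simp)
    qed
    also have "\<dots> = (\<Sum>y\<in>A (Suc n). \<Sum>v\<in>?P. if v (Suc n) = y then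
        (if v 0 = b then fan n v * T b y a / p b y else 0) else 0)"
      using fins by (intro sum_split_by_value) auto
    also have "\<dots> = (\<Sum>y\<in>A (Suc n). T b y a / p b y *
        (\<Sum>v\<in>?P. if v (Suc n) = y \<and> v 0 = b then fan n v else 0))"
      unfolding sum_distrib_left by (intro sum.cong) auto
    also have "\<dots> \<le> (\<Sum>y\<in>A (Suc n). T b y a / p b y * (p y b * R))"
      by (intro sum_mono mult_left_mono close) auto
    also have "\<dots> \<le> (\<Sum>y\<in>A (Suc n). T a b y * R)"
    proof (rule sum_mono)
      fix y
      have "T b y a = T a b y" using T_swap12 T_swap23 by metis
      thus "T b y a / p b y * (p y b * R) \<le> T a b y * R"
        using R0 p_commute[of b y] by (cases "p b y = 0") auto
    qed
    also have "\<dots> = (\<Sum>y\<in>A (Suc n). T a b y) * R" by (rule sum_distrib_right[symmetric])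
    also have "\<dots> \<le> (m (Suc n) * p a b) * R" using R0 by (intro mult_right_mono bnd') auto
    also have "\<dots> = p a b * prod m (insert (Suc n) ({..<?k} - {Suc n, 0}))"
      unfolding R_def by simp
    also have "insert (Suc n) ({..<?k} - {Suc n, 0}) = {..<Suc n + 2} - {?k, 0}" by auto
    finally show ?thesis unfolding expand unfolding nxt unfolding 3 .
  qed
qed

text \<open>Each new apex keeps at least half of the weight: the earlier vertices account for at
  most \<open>(n + 2) * N\<close>, hence at most half of the degree of the current diagonal, while
  all apexes together account for at least that degree.\<close>

lemma fan_total_ge:
  assumes "2 * real (n + 2) \<le> t"
  shows "(1/2) ^ n * real (card E) \<le>
    (\<Sum>v\<in>PiE {..<n + 2} (\<lambda>_. V). if inj_on v {..<n + 2} then fan n v else 0)"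
  using assms
proof (induction n)
  case 0
  \<comment> \<open>Every edge contains an ordered pair of distinct vertices, so the pair degrees
    sum to at least \<open>card E\<close>.\<close>
  have "real (card E) = (\<Sum>e\<in>E. 1)" by simp
  also have "\<dots> \<le> (\<Sum>e\<in>E. \<Sum>x\<in>V. \<Sum>y\<in>V. if x \<noteq> y \<and> x \<in> e \<and> y \<in> e then 1 else 0)"
  proof (rule sum_mono)
    fix e assume e: "e \<in> E"
    hence "Suc (Suc 0) \<le> card e" using edge[OF e] r3 by simp
    then obtain x y where xy: "x \<in> e" "y \<in> e" "x \<noteq> y"
      unfolding card_le_Suc_iff by auto
    have V: "x \<in> V" "y \<in> V" using xy edge[OF e] by auto
    have "1 = (if x \<noteq> y \<and> x \<in> e \<and> y \<in> e then 1 else (0::real))" using xy by simp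
    also have "\<dots> \<le> (\<Sum>y\<in>V. if x \<noteq> y \<and> x \<in> e \<and> y \<in> e then 1 else 0)"
      using V finite_V by (intro member_le_sum[where f = "\<lambda>y. if x \<noteq> y \<and> x \<in> e \<and> y \<in> e then 1 else 0"]) auto
    also have "\<dots> \<le> (\<Sum>x\<in>V. \<Sum>y\<in>V. if x \<noteq> y \<and> x \<in> e \<and> y \<in> e then 1 else 0)"
      using V finite_V
      by (intro member_le_sum[where f = "\<lambda>x. \<Sum>y\<in>V. if x \<noteq> y \<and> x \<in> e \<and> y \<in> e then 1 else 0"])
        (auto intro: sum_nonneg)
    finally show "1 \<le> (\<Sum>x\<in>V. \<Sum>y\<in>V. if x \<noteq> y \<and> x \<in> e \<and> y \<in> e then 1 else (0::real))" .
  qed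
  also have "\<dots> = (\<Sum>x\<in>V. \<Sum>e\<in>E. \<Sum>y\<in>V. if x \<noteq> y \<and> x \<in> e \<and> y \<in> e then 1 else 0)"
    by (rule sum.swap)
  also have "\<dots> = (\<Sum>x\<in>V. \<Sum>y\<in>V. \<Sum>e\<in>E. if x \<noteq> y \<and> x \<in> e \<and> y \<in> e then 1 else 0)"
    by (rule sum.cong[OF refl], rule sum.swap)
  also have "\<dots> = (\<Sum>x\<in>V. \<Sum>y\<in>V. p x y)"
    unfolding pair_degree_def using finite_E by (simp add: sum.If_cases Int_def)
  also have "\<dots> = (\<Sum>v\<in>PiE {..<(0::nat) + 2} (\<lambda>_. V). p (v 0) (v 1))"
    unfolding add_0 numeral_2_eq_2 sum_PiE_lessThan_Suc by simp
  also have "\<dots> = (\<Sum>v\<in>PiE {..<(0::nat) + 2} (\<lambda>_. V). if inj_on v {..<0 + 2} then fan 0 v else 0)"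
  proof (rule sum.cong[OF refl])
    fix v :: "nat \<Rightarrow> 'a"
    have "inj_on v {..<0 + 2} \<longleftrightarrow> v 0 \<noteq> v 1"
      unfolding add_0 numeral_2_eq_2 lessThan_Suc by auto
    moreover have "p (v 0) (v 1) = 0" if "v 0 = v 1" using that unfolding pair_degree_def by simp
    ultimately show "p (v 0) (v 1) = (if inj_on v {..<0 + 2} then fan 0 v else 0)" by simp
  qed
  finally show ?case by simp
next
  case (Suc n)
  let ?k = "n + 2"
  let ?P = "PiE {..<?k} (\<lambda>_. V)"
  let ?g = "\<lambda>v x. fan n v * T (v 0) (v (Suc n)) x / p (v 0) (v (Suc n))"
  have k3: "Suc n + 2 = Suc ?k" by simp
  have step: "fan (Suc n) (v(?k := x)) = ?g v x" for v x by simp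
  have "(1/2) ^ Suc n * real (card E) \<le>
      (1/2) * (\<Sum>v\<in>?P. if inj_on v {..<?k} then fan n v else 0)"
    using Suc by simp
  also have "\<dots> = (\<Sum>v\<in>?P. (1/2) * (if inj_on v {..<?k} then fan n v else 0))"
    by (rule sum_distrib_left)
  also have "\<dots> \<le> (\<Sum>v\<in>?P. \<Sum>x\<in>V. if inj_on (v(?k := x)) {..<Suc ?k} then ?g v x else 0)"
  proof (rule sum_mono)
    fix v
    let ?q = "p (v 0) (v (Suc n))"
    have inj: "inj_on (v(?k := x)) {..<Suc ?k} \<longleftrightarrow> inj_on v {..<?k} \<and> x \<notin> v ` {..<?k}" for x
    proof -
      have "inj_on (v(?k := x)) {..<?k} \<longleftrightarrow> inj_on v {..<?k}" by (rule inj_on_cong) auto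
      moreover have "(v(?k := x)) ` {..<?k} = v ` {..<?k}" by (rule image_cong) auto
      ultimately show ?thesis unfolding lessThan_Suc inj_on_insert by auto
    qed
    show "(1/2) * (if inj_on v {..<?k} then fan n v else 0)
      \<le> (\<Sum>x\<in>V. if inj_on (v(?k := x)) {..<Suc ?k} then ?g v x else 0)"
    proof (cases "inj_on v {..<?k} \<and> fan n v \<noteq> 0")
      case False
      have "0 \<le> (\<Sum>x\<in>V. if inj_on (v(?k := x)) {..<Suc ?k} then ?g v x else 0)"
        by (intro sum_nonneg) auto
      thus ?thesis using False by auto
    next
      case True
      \<comment> \<open>Side \<open>Suc n\<close> is the closing side, that is, the diagonal whose
        degree is divided by.\<close>
      have q: "?q \<noteq> 0"
        using fan_sides_nonzero[of n v "Suc n"] True p_commute by simp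
      hence qt: "t * N \<le> ?q" using pair_ge by blast
      have "(\<Sum>x\<in>v ` {..<?k}. T (v 0) (v (Suc n)) x) \<le> real (card (v ` {..<?k})) * N"
        using triple_le by (intro sum_bounded_above)
      also have "\<dots> \<le> real ?k * N"
        using N_pos card_image_le[of "{..<?k}" v] by (intro mult_right_mono) auto
      also have "\<dots> \<le> (t / 2) * N" using Suc.prems N_pos by (intro mult_right_mono) auto
      also have "\<dots> \<le> ?q / 2" using qt by simp
      finally have bad: "(\<Sum>x\<in>v ` {..<?k}. T (v 0) (v (Suc n)) x) \<le> ?q / 2" .
      have "(\<Sum>x\<in>V. T (v 0) (v (Suc n)) x)
        \<le> (\<Sum>x\<in>(V - v ` {..<?k}) \<union> v ` {..<?k}. T (v 0) (v (Suc n)) x)"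
        using finite_V by (intro sum_mono2) auto
      also have "\<dots> = (\<Sum>x\<in>V - v ` {..<?k}. T (v 0) (v (Suc n)) x)
          + (\<Sum>x\<in>v ` {..<?k}. T (v 0) (v (Suc n)) x)"
        using finite_V by (intro sum.union_disjoint) auto
      finally have "?q / 2 \<le> (\<Sum>x\<in>V - v ` {..<?k}. T (v 0) (v (Suc n)) x)"
        using bad sum_T_ge[of "v 0" "v (Suc n)"] by linarith
      hence "fan n v / ?q * (?q / 2) \<le> fan n v / ?q * (\<Sum>x\<in>V - v ` {..<?k}. T (v 0) (v (Suc n)) x)"
        by (intro mult_left_mono) auto
      also have "\<dots> = (\<Sum>x\<in>V - v ` {..<?k}. ?g v x)" by (simp add: sum_distrib_left)
      also have "\<dots> = (\<Sum>x\<in>V. if x \<notin> v ` {..<?k} then ?g v x else 0)"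
        using finite_V by (simp add: sum.If_cases Diff_eq Compl_eq)
      also have "\<dots> = (\<Sum>x\<in>V. if inj_on (v(?k := x)) {..<Suc ?k} then ?g v x else 0)"
        unfolding inj using True by simp
      finally show ?thesis using True q by simp
    qed
  qed
  also have "\<dots> = (\<Sum>v\<in>PiE {..<Suc n + 2} (\<lambda>_. V).
      if inj_on v {..<Suc n + 2} then fan (Suc n) v else 0)"
    unfolding k3 sum_PiE_lessThan_Suc step by (rule refl)
  finally show ?case .
qed

text \<open>The edges are attached one side at a time. An unsuitable edge through the current side
  contains a further vertex of the set \<open>X\<close> of vertices used so far, so there are at
  most \<open>card X * N\<close> of them. As \<open>card X\<close> is at most
  \<open>k * (r - 1)\<close>, this is at most half of all edges through the side.\<close>

lemma sum_pendant_edges_ge: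
  assumes t: "2 * real k * (real r - 1) \<le> t" and k: "2 \<le> k"
    and sides: "\<And>i. i < k \<Longrightarrow> p (v i) (v (Suc i mod k)) \<noteq> 0" and "m \<le> k"
  shows "(1/2) ^ m \<le> (\<Sum>e\<in>PiE {..<m} (\<lambda>_. E).
    if cycle_config k m v e then \<Prod>i<m. 1 / p (v i) (v (Suc i mod k)) else 0)"
  using \<open>m \<le> k\<close>
proof (induction m)
  case 0
  then show ?case by (simp add: cycle_config_def)
next
  case (Suc m)
  let ?Q = "PiE {..<m} (\<lambda>_. E)"
  define a b where "a = v m" and "b = v (Suc m mod k)"
  define W where "W = (\<Prod>i<m. 1 / p (v i) (v (Suc i mod k)))"
  have W0: "0 \<le> W" unfolding W_def by (intro prod_nonneg) auto
  have m: "m < k" using Suc.prems by simp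
  have q: "p a b \<noteq> 0" using sides[OF m] unfolding a_def b_def .
  have "(1/2) ^ Suc m \<le> (1/2) * (\<Sum>e\<in>?Q. if cycle_config k m v e then W else 0)"
    using Suc unfolding W_def by simp
  also have "\<dots> = (\<Sum>e\<in>?Q. (1/2) * (if cycle_config k m v e then W else 0))"
    by (rule sum_distrib_left)
  also have "\<dots> \<le> (\<Sum>e\<in>?Q. \<Sum>x\<in>E. if cycle_config k (Suc m) v (e(m := x)) then W * (1 / p a b) else 0)"
  proof (rule sum_mono)
    fix e assume e: "e \<in> ?Q"
    define X where "X = v ` {..<k} \<union> (\<Union>l<m. e l)"
    have upd: "cycle_config k (Suc m) v (e(m := x)) \<longleftrightarrow> cycle_config k m v e \<and> x \<inter> X = {a, b}" for x
    proof -
      have un: "(\<Union>l<i. (e(m := x)) l) = (\<Union>l<i. e l)" if "i \<le> m" for i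
        using that by (intro SUP_cong) auto
      have "(\<forall>i<m. (e(m := x)) i \<inter> (v ` {..<k} \<union> (\<Union>l<i. (e(m := x)) l)) = {v i, v (Suc i mod k)})
          \<longleftrightarrow> cycle_config k m v e"
        unfolding cycle_config_def
      proof (intro all_cong)
        fix i assume i: "i < m"
        show "((e(m := x)) i \<inter> (v ` {..<k} \<union> (\<Union>l<i. (e(m := x)) l)) = {v i, v (Suc i mod k)})
          = (e i \<inter> (v ` {..<k} \<union> (\<Union>l<i. e l)) = {v i, v (Suc i mod k)})"
          unfolding un[OF less_imp_le[OF i]] using i by simp
      qed
      thus ?thesis unfolding cycle_config_def[of k "Suc m"] All_less_Suc un[OF order.refl] X_def a_def b_def
        unfolding fun_upd_same by (simp only: conj_commute)
    qed
    show "(1/2) * (if cycle_config k m v e then W else 0)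
      \<le> (\<Sum>x\<in>E. if cycle_config k (Suc m) v (e(m := x)) then W * (1 / p a b) else 0)"
    proof (cases "cycle_config k m v e")
      case False
      then show ?thesis unfolding upd by simp
    next
      case True
      have eE: "e l \<in> E" if "l < m" for l using e that by auto
      have fin_e: "finite (e l)" if "l < m" for l
        using edge[OF eE[OF that]] finite_V finite_subset by blast
      have finX: "finite X" unfolding X_def using fin_e by auto
      \<comment> \<open>Each attached edge contributes only its \<open>r - 2\<close> inner vertices
        beyond the \<open>k\<close> polygon vertices.\<close>
      have "X \<subseteq> v ` {..<k} \<union> (\<Union>l<m. e l - {v l, v (Suc l mod k)})"
      proof -
        have "v l \<in> v ` {..<k}" "v (Suc l mod k) \<in> v ` {..<k}" if "l < m" for l
          using that m k by auto
        thus ?thesis unfolding X_def by blast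
      qed
      hence "card X \<le> card (v ` {..<k} \<union> (\<Union>l<m. e l - {v l, v (Suc l mod k)}))"
        using fin_e by (intro card_mono) auto
      also have "\<dots> \<le> card (v ` {..<k}) + card (\<Union>l<m. e l - {v l, v (Suc l mod k)})"
        by (rule card_Un_le)
      also have "\<dots> \<le> k + (\<Sum>l<m. card (e l - {v l, v (Suc l mod k)}))"
        using card_image_le[of "{..<k}" v] by (intro add_mono card_UN_le) auto
      also have "(\<Sum>l<m. card (e l - {v l, v (Suc l mod k)})) = (\<Sum>l<m. r - 2)"
      proof (rule sum.cong[OF refl])
        fix l assume "l \<in> {..<m}"
        hence l: "l < m" "l < k" using m by auto
        have "{v l, v (Suc l mod k)} \<subseteq> e l" using True l unfolding cycle_config_def by blast
        moreover have "v l \<noteq> v (Suc l mod k)" using sides[OF l(2)] unfolding pair_degree_def by auto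
        ultimately show "card (e l - {v l, v (Suc l mod k)}) = r - 2"
          using edge[OF eE[OF l(1)]] by (simp add: card_Diff_subset)
      qed
      also have "k + (\<Sum>l<m. r - 2) \<le> k + k * (r - 2)" using m by simp
      also have "\<dots> = k * (r - 1)"
      proof -
        have "r - 1 = Suc (r - 2)" using r3 by simp
        thus ?thesis by simp
      qed
      finally have cardX: "card X \<le> k * (r - 1)" .
      have "a \<in> X" "b \<in> X" unfolding X_def a_def b_def using m k by auto
      have "{x \<in> E. a \<noteq> b \<and> a \<in> x \<and> b \<in> x} \<subseteq>
        {x \<in> E. x \<inter> X = {a, b}} \<union> (\<Union>w\<in>X. {x \<in> E. distinct [a, b, w] \<and> {a, b, w} \<subseteq> x})"
      proof
        fix x assume x: "x \<in> {x \<in> E. a \<noteq> b \<and> a \<in> x \<and> b \<in> x}"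
        show "x \<in> {x \<in> E. x \<inter> X = {a, b}} \<union> (\<Union>w\<in>X. {x \<in> E. distinct [a, b, w] \<and> {a, b, w} \<subseteq> x})"
        proof (cases "x \<inter> X = {a, b}")
          case False
          then obtain w where "w \<in> x" "w \<in> X" "w \<noteq> a" "w \<noteq> b" using x \<open>a \<in> X\<close> \<open>b \<in> X\<close> by blast
          thus ?thesis using x by auto
        qed (use x in auto)
      qed
      hence "card {x \<in> E. a \<noteq> b \<and> a \<in> x \<and> b \<in> x} \<le> card ({x \<in> E. x \<inter> X = {a, b}} \<union>
          (\<Union>w\<in>X. {x \<in> E. distinct [a, b, w] \<and> {a, b, w} \<subseteq> x}))"
        using finite_E finX by (intro card_mono) auto
      also have "\<dots> \<le> card {x \<in> E. x \<inter> X = {a, b}} +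
          card (\<Union>w\<in>X. {x \<in> E. distinct [a, b, w] \<and> {a, b, w} \<subseteq> x})"
        by (rule card_Un_le)
      also have "\<dots> \<le> card {x \<in> E. x \<inter> X = {a, b}} +
          (\<Sum>w\<in>X. card {x \<in> E. distinct [a, b, w] \<and> {a, b, w} \<subseteq> x})"
        using finX by (intro add_left_mono card_UN_le)
      finally have "p a b \<le> real (card {x \<in> E. x \<inter> X = {a, b}} +
          (\<Sum>w\<in>X. card {x \<in> E. distinct [a, b, w] \<and> {a, b, w} \<subseteq> x}))"
        unfolding pair_degree_def by (rule of_nat_mono)
      hence "p a b \<le> real (card {x \<in> E. x \<inter> X = {a, b}}) + (\<Sum>w\<in>X. T a b w)"
        unfolding triple_degree_def by simp
      also have "(\<Sum>w\<in>X. T a b w) \<le> real (card X) * N"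
        using triple_le by (intro sum_bounded_above)
      also have "\<dots> \<le> real (k * (r - 1)) * N" using cardX N_pos by (intro mult_right_mono) (auto simp del: of_nat_mult)
      also have "\<dots> \<le> (t / 2) * N" using t r3 N_pos by (intro mult_right_mono) (auto simp: of_nat_diff)
      also have "\<dots> \<le> p a b / 2" using pair_ge[of a b] q by simp
      finally have "p a b / 2 \<le> real (card {x \<in> E. x \<inter> X = {a, b}})" by linarith
      hence "W / p a b * (p a b / 2) \<le> W / p a b * real (card {x \<in> E. x \<inter> X = {a, b}})"
        using W0 by (intro mult_left_mono) auto
      also have "\<dots> = (\<Sum>x\<in>E. if x \<inter> X = {a, b} then W * (1 / p a b) else 0)"
        using finite_E by (simp add: sum.If_cases Int_def)
      finally show ?thesis using True q unfolding upd by simp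
    qed
  qed
  also have "\<dots> = (\<Sum>e\<in>PiE {..<Suc m} (\<lambda>_. E).
      if cycle_config k (Suc m) v e then \<Prod>i<Suc m. 1 / p (v i) (v (Suc i mod k)) else 0)"
    unfolding sum_PiE_lessThan_Suc W_def a_def b_def prod.lessThan_Suc by (rule refl)
  finally show ?case .
qed

section \<open>Weights of polygons with an edge attached to each side\<close>

definition share :: "nat \<Rightarrow> (nat \<Rightarrow> 'a) \<Rightarrow> nat \<Rightarrow> 'a set \<Rightarrow> real" where
  "share k v i y =
     (if v i \<in> y \<and> v (Suc i mod k) \<in> y then 1 / p (v i) (v (Suc i mod k)) else 0)"

text \<open>The unnormalised law of the random cycle: \<open>n\<close> triangles give
  \<open>n + 2\<close> sides, and each side independently receives a uniform edge through it.
  Degenerate outcomes carry weight too; upper bounds may include them.\<close>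

definition config_weight :: "nat \<Rightarrow> (nat \<Rightarrow> 'a) \<times> (nat \<Rightarrow> 'a set) \<Rightarrow> real" where
  "config_weight n = (\<lambda>(v, e). fan n v * (\<Prod>i<n + 2. share (n + 2) v i (e i)))"

lemma share_nonneg [simp]: "0 \<le> share k v i y"
  unfolding share_def by simp

lemma config_weight_nonneg: "0 \<le> config_weight n \<omega>"
  unfolding config_weight_def by (cases \<omega>) (auto intro!: mult_nonneg_nonneg prod_nonneg)

lemma share_le: "share k v i y \<le> 1 / (t * N)"
proof (cases "p (v i) (v (Suc i mod k)) = 0")
  case True
  then show ?thesis unfolding share_def using t_pos N_pos by simp
next
  case False
  hence "t * N \<le> p (v i) (v (Suc i mod k))" using pair_ge by blast
  hence "1 / p (v i) (v (Suc i mod k)) \<le> 1 / (t * N)" using t_pos N_pos by (intro frac_le) auto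
  then show ?thesis unfolding share_def using t_pos N_pos by simp
qed

lemma sum_share_le: "(\<Sum>y\<in>E. share k v i y) \<le> 1"
proof (cases "p (v i) (v (Suc i mod k)) = 0")
  case True
  hence "share k v i y = 0" for y unfolding share_def by simp
  then show ?thesis by simp
next
  case False
  hence "v i \<noteq> v (Suc i mod k)" unfolding pair_degree_def by auto
  hence "(\<Sum>y\<in>E. share k v i y) = p (v i) (v (Suc i mod k)) * (1 / p (v i) (v (Suc i mod k)))"
    unfolding share_def pair_degree_def using finite_E by (simp add: sum.If_cases Int_def)
  then show ?thesis using False by simp
qed

text \<open>The fan is read from a prescribed side \<open>s\<close>. Its ends have at most
  \<open>r ^ 2\<close> choices in \<open>a s\<close>, and its pair degree cancels against its share.
  Each other prescribed edge costs \<open>1 / (t * N)\<close>, each other vertex in \<open>S\<close>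
  costs \<open>r / t\<close> because it lies in a prescribed edge, and a free vertex costs
  \<open>r\<close>.\<close>

lemma prescribed_edges_weight_le:
  fixes a :: "nat \<Rightarrow> 'a set" and n :: nat
  assumes I: "I \<subseteq> {..<n + 2}" "I \<noteq> {}" and a: "\<And>i. i \<in> I \<Longrightarrow> a i \<in> E"
  defines "S \<equiv> I \<union> (\<lambda>i. Suc i mod (n + 2)) ` I"
  shows "(\<Sum>v\<in>PiE {..<n + 2} (\<lambda>_. V). \<Sum>e\<in>PiE {..<n + 2} (\<lambda>i. if i \<in> I then {a i} else E).
      config_weight n (v, e)) \<le> real r ^ (n + 2) / (t ^ (card S - 2) * (t * N) ^ (card I - 1))"
proof -
  let ?k = "n + 2"
  let ?P = "PiE {..<?k} (\<lambda>_. V)"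
  obtain s where s: "s \<in> I" using I by blast
  define s' where "s' = Suc s mod ?k"
  have sk: "s < ?k" "s' < ?k" "s \<noteq> s'" using s I unfolding s'_def by (auto simp: mod_Suc)
  have sS: "s \<in> S" "s' \<in> S" unfolding S_def s'_def using s by auto
  have S: "S \<subseteq> {..<?k}" unfolding S_def using I by auto
  have finI: "finite I" using I finite_subset by blast
  \<comment> \<open>A position is confined to the prescribed edges on the sides that start or end
    there.\<close>
  define A where "A l = {x \<in> V. (l \<in> I \<longrightarrow> x \<in> a l) \<and> (\<forall>i\<in>I. Suc i mod ?k = l \<longrightarrow> x \<in> a i)}" for l
  define m where "m l = (if l \<in> S then real r / t else real r)" for l
  have finA: "finite (A l)" for l unfolding A_def using finite_V by simp
  have fin_a: "finite (a i)" "card (a i) = r" if "i \<in> I" for i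
    using edge[OF a[OF that]] finite_V finite_subset by auto
  have cardA: "card (A l) \<le> r" if lS: "l \<in> S" for l
  proof -
    obtain i where i: "i \<in> I" "A l \<subseteq> a i" using lS unfolding S_def A_def by blast
    hence "card (A l) \<le> card (a i)" using fin_a by (intro card_mono) auto
    thus ?thesis using fin_a(2)[OF i(1)] by simp
  qed
  have m0: "0 \<le> m l" for l unfolding m_def using t_pos by simp
  have bnd: "(\<Sum>x\<in>A l. T b c x) \<le> m l * p b c" for l b c
  proof (cases "l \<in> S")
    case True
    then show ?thesis unfolding m_def using sum_T_le_small[OF cardA[OF True]] by simp
  next
    case False
    have "(\<Sum>x\<in>A l. T b c x) \<le> (\<Sum>x\<in>V. T b c x)"
      unfolding A_def using finite_V by (intro sum_mono2) auto
    also have "\<dots> \<le> real r * p b c" by (rule sum_T_le)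
    finally show ?thesis unfolding m_def using False by simp
  qed
  define M where "M = prod m ({..<?k} - {s, s'})"
  have M: "M = real r ^ n / t ^ (card S - 2)"
  proof -
    have "M = (\<Prod>l\<in>{..<?k} - {s, s'}. real r * (if l \<in> S then 1 / t else 1))"
      unfolding M_def m_def by (intro prod.cong) auto
    also have "\<dots> = real r ^ card ({..<?k} - {s, s'}) * (\<Prod>l\<in>{..<?k} - {s, s'}. if l \<in> S then 1 / t else 1)"
      by (simp add: prod.distrib)
    also have "(\<Prod>l\<in>{..<?k} - {s, s'}. if l \<in> S then 1 / t else 1) = (1 / t) ^ card (S - {s, s'})"
    proof -
      have "({..<?k} - {s, s'}) \<inter> S = S - {s, s'}" using S by auto
      thus ?thesis by (simp add: prod.If_cases)
    qed
    also have "card ({..<?k} - {s, s'}) = n" using sk by (simp add: card_Diff_subset)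
    also have "card (S - {s, s'}) = card S - 2" using sk sS by (simp add: card_Diff_subset)
    finally show ?thesis by (simp add: power_divide)
  qed
  have M0: "0 \<le> M" unfolding M_def using m0 by (intro prod_nonneg) auto
  define L where "L = (1 / (t * N)) ^ (card I - 1)"
  have L0: "0 \<le> L" unfolding L_def using t_pos N_pos by simp
  \<comment> \<open>Free edges are summed out, since the shares of one side sum to at most
    1.\<close>
  have edges_out: "(\<Sum>e\<in>PiE {..<?k} (\<lambda>i. if i \<in> I then {a i} else E). config_weight n (v, e))
      \<le> fan n v * (\<Prod>i\<in>I. share ?k v i (a i))" for v
  proof -
    have "(\<Sum>e\<in>PiE {..<?k} (\<lambda>i. if i \<in> I then {a i} else E). config_weight n (v, e))
      = fan n v * (\<Prod>i<?k. \<Sum>y\<in>(if i \<in> I then {a i} else E). share ?k v i y)"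
      unfolding config_weight_def using finite_E
      by (subst prod_sum_PiE) (auto simp: sum_distrib_left)
    also have "\<dots> \<le> fan n v * (\<Prod>i<?k. if i \<in> I then share ?k v i (a i) else 1)"
      by (intro mult_left_mono prod_mono) (auto intro: sum_nonneg sum_share_le)
    also have "(\<Prod>i<?k. if i \<in> I then share ?k v i (a i) else 1) = (\<Prod>i\<in>I. share ?k v i (a i))"
      using I by (intro prod.mono_neutral_cong_right) auto
    finally show ?thesis .
  qed
  \<comment> \<open>Outside the box some prescribed share vanishes. Inside it, only the share of
    \<open>s\<close> keeps its exact denominator, for the cancellation with
    \<open>fan_box_le\<close>; the others are bounded by \<open>share_le\<close>.\<close>
  have inbox: "fan n v * (\<Prod>i\<in>I. share ?k v i (a i))
      \<le> (if v \<in> PiE {..<?k} A then L * (fan n v * (1 / p (v s) (v s'))) else 0)" if v: "v \<in> ?P" for v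
  proof (cases "v \<in> PiE {..<?k} A")
    case True
    have "(\<Prod>i\<in>I. share ?k v i (a i)) = share ?k v s (a s) * (\<Prod>i\<in>I - {s}. share ?k v i (a i))"
      using finI s by (rule prod.remove)
    also have "\<dots> \<le> (1 / p (v s) (v s')) * (\<Prod>i\<in>I - {s}. 1 / (t * N))"
    proof (intro mult_mono prod_mono prod_nonneg)
      show "share ?k v s (a s) \<le> 1 / p (v s) (v s')" unfolding share_def s'_def by simp
    qed (use share_le in auto)
    also have "\<dots> = L * (1 / p (v s) (v s'))" unfolding L_def using s by simp
    finally have "fan n v * (\<Prod>i\<in>I. share ?k v i (a i)) \<le> fan n v * (L * (1 / p (v s) (v s')))"
      by (intro mult_left_mono) auto
    thus ?thesis using True by (simp add: mult_ac)
  next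
    case False
    then obtain l where l: "l < ?k" "v l \<notin> A l" using v by (auto simp: PiE_iff)
    hence "\<exists>i\<in>I. share ?k v i (a i) = 0" using v unfolding A_def share_def by (auto simp: PiE_iff)
    hence "(\<Prod>i\<in>I. share ?k v i (a i)) = 0" using finI by (simp add: prod_zero_iff)
    thus ?thesis using False by simp
  qed
  have "(\<Sum>v\<in>?P. \<Sum>e\<in>PiE {..<?k} (\<lambda>i. if i \<in> I then {a i} else E). config_weight n (v, e))
    \<le> (\<Sum>v\<in>?P. if v \<in> PiE {..<?k} A then L * (fan n v * (1 / p (v s) (v s'))) else 0)"
    using edges_out inbox by (intro sum_mono) (meson order.trans)
  also have "\<dots> = (\<Sum>v\<in>PiE {..<?k} A. L * (fan n v * (1 / p (v s) (v s'))))"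
  proof -
    have "?P \<inter> PiE {..<?k} A = PiE {..<?k} A" unfolding A_def by (auto simp: PiE_iff)
    thus ?thesis using finite_V by (simp add: sum.If_cases finite_PiE)
  qed
  also have "\<dots> = L * (\<Sum>v\<in>PiE {..<?k} A. fan n v * (1 / p (v s) (v s')))"
    by (rule sum_distrib_left[symmetric])
  also have "\<dots> \<le> L * (real r ^ 2 * M)"
  proof (rule mult_left_mono[OF _ L0])
    have "(\<Sum>v\<in>PiE {..<?k} A. fan n v * (1 / p (v s) (v s')))
      = (\<Sum>x\<in>A s. \<Sum>v\<in>PiE {..<?k} A. if v s = x then fan n v * (1 / p x (v s')) else 0)"
      using finA sk by (intro sum_split_by_value) auto
    also have "\<dots> = (\<Sum>x\<in>A s. \<Sum>y\<in>A s'. \<Sum>v\<in>PiE {..<?k} A. if v s' = y then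
        (if v s = x then fan n v * (1 / p x y) else 0) else 0)"
      using finA sk by (intro sum.cong[OF refl] sum_split_by_value) auto
    also have "\<dots> = (\<Sum>x\<in>A s. \<Sum>y\<in>A s'. (1 / p x y) *
        (\<Sum>v\<in>PiE {..<?k} A. if v s = x \<and> v s' = y then fan n v else 0))"
      unfolding sum_distrib_left by (intro sum.cong) auto
    also have "\<dots> \<le> (\<Sum>x\<in>A s. \<Sum>y\<in>A s'. (1 / p x y) * (p x y * M))"
      unfolding M_def s'_def using finA m0 bnd sk
      by (intro sum_mono mult_left_mono fan_box_le) auto
    also have "\<dots> \<le> (\<Sum>x\<in>A s. \<Sum>y\<in>A s'. M)"
    proof (intro sum_mono)
      fix x y
      show "(1 / p x y) * (p x y * M) \<le> M" using M0 by (cases "p x y = 0") auto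
    qed
    also have "\<dots> = real (card (A s) * card (A s')) * M" by simp
    also have "\<dots> \<le> real (r * r) * M"
      using cardA sS M0 by (intro mult_right_mono of_nat_mono mult_le_mono) auto
    finally show "(\<Sum>v\<in>PiE {..<?k} A. fan n v * (1 / p (v s) (v s'))) \<le> real r ^ 2 * M"
      by (simp add: power2_eq_square)
  qed
  also have "\<dots> = real r ^ (n + 2) / (t ^ (card S - 2) * (t * N) ^ (card I - 1))"
    unfolding L_def M by (simp add: power_divide power_add power2_eq_square mult_ac)
  finally show ?thesis .
qed

section \<open>Total weight and marginals of cycle configurations\<close>

definition configs :: "nat \<Rightarrow> ((nat \<Rightarrow> 'a) \<times> (nat \<Rightarrow> 'a set)) set" where
  "configs n = {(v, e). v \<in> PiE {..<n + 2} (\<lambda>_. V) \<and> e \<in> PiE {..<n + 2} (\<lambda>_. E) \<and>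
     inj_on v {..<n + 2} \<and> cycle_config (n + 2) (n + 2) v e}"

lemma configs_subset: "configs n \<subseteq> PiE {..<n + 2} (\<lambda>_. V) \<times> PiE {..<n + 2} (\<lambda>_. E)"
  unfolding configs_def by auto

lemma finite_configs: "finite (configs n)"
  by (rule finite_subset[OF configs_subset]) (intro finite_cartesian_product finite_PiE finite_V finite_E finite_lessThan)

text \<open>An edge repeating an earlier one would lie inside the earlier union and so consist of
  its two ends only, against \<open>r3\<close>.\<close>

lemma config_edges_inj:
  assumes "(v, e) \<in> configs n"
  shows "inj_on e {..<n + 2}"
proof (rule linorder_inj_onI')
  fix i j assume ij: "i \<in> {..<n + 2}" "j \<in> {..<n + 2}" "i < j"
  show "e i \<noteq> e j"
  proof
    assume eq: "e i = e j"
    have "e j \<inter> (v ` {..<n + 2} \<union> (\<Union>l<j. e l)) = {v j, v (Suc j mod (n + 2))}"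
      using assms ij unfolding configs_def cycle_config_def by simp
    moreover have "e j \<subseteq> (\<Union>l<j. e l)" using ij eq by blast
    ultimately have "e j = {v j, v (Suc j mod (n + 2))}" by blast
    hence "card (e j) \<le> 2" by (simp add: card_insert_if)
    moreover have "e j \<in> E" using assms ij unfolding configs_def by auto
    ultimately show False using edge r3 by fastforce
  qed
qed

text \<open>The \<open>n\<close> apexes and the \<open>n + 2\<close> attached edges lose a factor 2
  each.\<close>

lemma configs_total_weight_ge:
  assumes t: "2 * real (n + 2) * (real r - 1) \<le> t"
  shows "(1/2) ^ (2 * n + 2) * real (card E) \<le> (\<Sum>\<omega>\<in>configs n. config_weight n \<omega>)"
proof -
  let ?k = "n + 2"
  let ?P = "PiE {..<?k} (\<lambda>_. V)" and ?Q = "PiE {..<?k} (\<lambda>_. E)"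
  have "2 * real ?k = 2 * real ?k * 1" by simp
  also have "\<dots> \<le> 2 * real ?k * (real r - 1)" using r3 by (intro mult_left_mono) auto
  also have "\<dots> \<le> t" by (rule t)
  finally have t2: "2 * real ?k \<le> t" .
  have "(1/2) ^ (2 * n + 2) * real (card E) = (1/2) ^ ?k * ((1/2) ^ n * real (card E))"
    unfolding mult.assoc[symmetric] power_add[symmetric] by (simp add: mult_2)
  also have "\<dots> \<le> (1/2) ^ ?k * (\<Sum>v\<in>?P. if inj_on v {..<?k} then fan n v else 0)"
    using fan_total_ge[OF t2] by (intro mult_left_mono) auto
  also have "\<dots> = (\<Sum>v\<in>?P. (1/2) ^ ?k * (if inj_on v {..<?k} then fan n v else 0))"
    by (rule sum_distrib_left)
  also have "\<dots> \<le> (\<Sum>v\<in>?P. \<Sum>e\<in>?Q. if inj_on v {..<?k} \<and> cycle_config ?k ?k v e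
      then config_weight n (v, e) else 0)"
  proof (rule sum_mono)
    fix v
    show "(1/2) ^ ?k * (if inj_on v {..<?k} then fan n v else 0) \<le>
      (\<Sum>e\<in>?Q. if inj_on v {..<?k} \<and> cycle_config ?k ?k v e then config_weight n (v, e) else 0)"
    proof (cases "inj_on v {..<?k} \<and> fan n v \<noteq> 0")
      case False
      have "0 \<le> (\<Sum>e\<in>?Q. if inj_on v {..<?k} \<and> cycle_config ?k ?k v e then config_weight n (v, e) else 0)"
        by (intro sum_nonneg) (auto simp: config_weight_nonneg)
      thus ?thesis using False by auto
    next
      case True
      have sides: "p (v i) (v (Suc i mod ?k)) \<noteq> 0" if "i < ?k" for i
        using True that fan_sides_nonzero by blast
      have "fan n v * (1/2) ^ ?k \<le> fan n v * (\<Sum>e\<in>?Q. if cycle_config ?k ?k v e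
          then \<Prod>i<?k. 1 / p (v i) (v (Suc i mod ?k)) else 0)"
        using sides t by (intro mult_left_mono sum_pendant_edges_ge) auto
      also have "\<dots> = (\<Sum>e\<in>?Q. fan n v * (if cycle_config ?k ?k v e
          then \<Prod>i<?k. 1 / p (v i) (v (Suc i mod ?k)) else 0))"
        by (rule sum_distrib_left)
      also have "\<dots> = (\<Sum>e\<in>?Q. if inj_on v {..<?k} \<and> cycle_config ?k ?k v e then config_weight n (v, e) else 0)"
      proof (rule sum.cong[OF refl])
        fix e
        show "fan n v * (if cycle_config ?k ?k v e then \<Prod>i<?k. 1 / p (v i) (v (Suc i mod ?k)) else 0)
          = (if inj_on v {..<?k} \<and> cycle_config ?k ?k v e then config_weight n (v, e) else 0)"
        proof (cases "cycle_config ?k ?k v e")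
          case cfg: True
          have "share ?k v i (e i) = 1 / p (v i) (v (Suc i mod ?k))" if "i < ?k" for i
          proof -
            have "{v i, v (Suc i mod ?k)} \<subseteq> e i" using cfg that unfolding cycle_config_def by blast
            thus ?thesis unfolding share_def by simp
          qed
          hence "(\<Prod>i<?k. share ?k v i (e i)) = (\<Prod>i<?k. 1 / p (v i) (v (Suc i mod ?k)))"
            by (intro prod.cong) auto
          thus ?thesis using cfg True unfolding config_weight_def by simp
        qed simp
      qed
      finally show ?thesis using True by (simp add: mult.commute)
    qed
  qed
  also have "\<dots> = (\<Sum>\<omega>\<in>?P \<times> ?Q. if \<omega> \<in> configs n then config_weight n \<omega> else 0)"
    unfolding sum.cartesian_product by (intro sum.cong) (auto simp: configs_def)
  also have "\<dots> = (\<Sum>\<omega>\<in>configs n. config_weight n \<omega>)"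
    using configs_subset[of n] finite_V finite_E
    by (simp add: sum.If_cases finite_PiE Int_absorb1)
  finally show ?thesis .
qed

text \<open>Union bound over the positions \<open>I\<close> of the edges of \<sigma> and their
  assignment \<open>a\<close>, giving the factor \<open>2 ^ (n + 2) * (n + 2) ^ (n + 2)\<close>. The
  \<open>min\<close> reflects that the last side of a polygon covers no new vertex.\<close>

lemma configs_marginal_le:
  assumes t1: "1 \<le> t" and \<sigma>: "\<sigma> \<subseteq> E" "1 \<le> card \<sigma>" "card \<sigma> \<le> n + 2"
  shows "(\<Sum>\<omega> | \<omega> \<in> configs n \<and> \<sigma> \<subseteq> snd \<omega> ` {..<n + 2}. config_weight n \<omega>)
    \<le> 2 ^ (n + 2) * real (n + 2) ^ (n + 2) * real r ^ (n + 2) /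
       (t ^ min (card \<sigma> - 1) n * (t * N) ^ (card \<sigma> - 1))"
proof -
  let ?k = "n + 2"
  let ?P = "PiE {..<?k} (\<lambda>_. V)" and ?Q = "PiE {..<?k} (\<lambda>_. E)"
  have fin\<sigma>: "finite \<sigma>" using \<sigma>(1) finite_E finite_subset by blast
  obtain d where d: "d \<in> \<sigma>" using \<sigma>(2) by fastforce
  \<comment> \<open>Assignments are taken on all positions, which makes counting easy; positions
    outside \<open>I\<close> later receive the default \<open>d\<close>.\<close>
  define J where "J = {I. I \<subseteq> {..<?k} \<and> card I = card \<sigma>} \<times> PiE {..<?k} (\<lambda>_. \<sigma>)"
  define R where "R = (\<lambda>(I, a) (\<omega> :: (nat \<Rightarrow> 'a) \<times> (nat \<Rightarrow> 'a set)). \<forall>i\<in>I. snd \<omega> i = (a i :: 'a set))"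
  define Z where "Z = real r ^ ?k / (t ^ min (card \<sigma> - 1) n * (t * N) ^ (card \<sigma> - 1))"
  have Z0: "0 \<le> Z" unfolding Z_def using t_pos N_pos by simp
  have finJ: "finite J" unfolding J_def using fin\<sigma> by (auto intro: finite_PiE)
  have "card J \<le> 2 ^ ?k * card \<sigma> ^ ?k"
  proof -
    have "card {I. I \<subseteq> {..<?k} \<and> card I = card \<sigma>} \<le> card (Pow {..<?k})"
      by (intro card_mono) auto
    thus ?thesis unfolding J_def card_cartesian_product
      by (intro mult_le_mono) (auto simp: card_PiE card_Pow)
  qed
  also have "\<dots> \<le> 2 ^ ?k * ?k ^ ?k" using \<sigma>(3) by (intro mult_le_mono power_mono) auto
  finally have cardJ: "card J \<le> 2 ^ ?k * ?k ^ ?k" .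
  have each: "(\<Sum>\<omega> | \<omega> \<in> {\<omega> \<in> configs n. \<sigma> \<subseteq> snd \<omega> ` {..<?k}} \<and> R j \<omega>. config_weight n \<omega>) \<le> Z"
    if j: "j \<in> J" for j
  proof -
    obtain I a where ja: "j = (I, a)" by fastforce
    have I: "I \<subseteq> {..<?k}" "card I = card \<sigma>" and a: "a \<in> PiE {..<?k} (\<lambda>_. \<sigma>)"
      using j unfolding J_def ja by auto
    have "I \<noteq> {}" using I(2) \<sigma>(2) by auto
    define S where "S = I \<union> (\<lambda>i. Suc i mod ?k) ` I"
    have aE: "a i \<in> E" if "i \<in> I" for i using that I a \<sigma>(1) by blast
    have "(\<Sum>\<omega> | \<omega> \<in> {\<omega> \<in> configs n. \<sigma> \<subseteq> snd \<omega> ` {..<?k}} \<and> R j \<omega>. config_weight n \<omega>)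
      \<le> (\<Sum>\<omega>\<in>?P \<times> PiE {..<?k} (\<lambda>i. if i \<in> I then {a i} else E). config_weight n \<omega>)"
    proof (rule sum_mono2)
      show "finite (?P \<times> PiE {..<?k} (\<lambda>i. if i \<in> I then {a i} else E))"
        using finite_V finite_E by (intro finite_cartesian_product finite_PiE) auto
      show "{\<omega> \<in> {\<omega> \<in> configs n. \<sigma> \<subseteq> snd \<omega> ` {..<?k}}. R j \<omega>}
          \<subseteq> ?P \<times> PiE {..<?k} (\<lambda>i. if i \<in> I then {a i} else E)"
      proof
        fix \<omega> assume \<omega>: "\<omega> \<in> {\<omega> \<in> {\<omega> \<in> configs n. \<sigma> \<subseteq> snd \<omega> ` {..<?k}}. R j \<omega>}"
        hence "\<omega> \<in> ?P \<times> ?Q" using configs_subset[of n] by blast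
        moreover have "\<forall>i\<in>I. snd \<omega> i = a i" using \<omega> unfolding R_def ja by simp
        ultimately show "\<omega> \<in> ?P \<times> PiE {..<?k} (\<lambda>i. if i \<in> I then {a i} else E)"
          by (simp add: mem_Times_iff PiE_iff)
      qed
    qed (simp add: config_weight_nonneg)
    also have "\<dots> = (\<Sum>v\<in>?P. \<Sum>e\<in>PiE {..<?k} (\<lambda>i. if i \<in> I then {a i} else E). config_weight n (v, e))"
      unfolding sum.cartesian_product by (intro sum.cong) auto
    also have "\<dots> \<le> real r ^ ?k / (t ^ (card S - 2) * (t * N) ^ (card I - 1))"
      unfolding S_def by (rule prescribed_edges_weight_le[OF I(1) \<open>I \<noteq> {}\<close> aE])
    also have "\<dots> \<le> Z"
    proof -
      have finS: "finite S" unfolding S_def using I(1) finite_subset by auto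
      \<comment> \<open>Fewer than \<open>n + 2\<close> sides cover at least one vertex more than
        their number; all sides cover exactly \<open>n + 2\<close> vertices.\<close>
      have "min (card \<sigma> - 1) n \<le> card S - 2"
      proof (cases "card I < ?k")
        case True
        show ?thesis using card_less_card_Un_cyclic_Suc[OF I(1) \<open>I \<noteq> {}\<close> True] I(2)
          unfolding S_def by linarith
      next
        case False
        have "card I \<le> card S" unfolding S_def[symmetric] using finS
          by (intro card_mono) (auto simp: S_def)
        thus ?thesis using False by linarith
      qed
      hence "t ^ min (card \<sigma> - 1) n \<le> t ^ (card S - 2)" using t1 by (intro power_increasing)
      hence "t ^ min (card \<sigma> - 1) n * (t * N) ^ (card \<sigma> - 1)
          \<le> t ^ (card S - 2) * (t * N) ^ (card I - 1)"
        unfolding I(2) using t_pos N_pos by (intro mult_right_mono) auto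
      thus ?thesis unfolding Z_def using t_pos N_pos by (intro frac_le) auto
    qed
    finally show ?thesis .
  qed
  have "(\<Sum>\<omega>\<in>{\<omega> \<in> configs n. \<sigma> \<subseteq> snd \<omega> ` {..<?k}}. config_weight n \<omega>)
    \<le> (\<Sum>j\<in>J. \<Sum>\<omega> | \<omega> \<in> {\<omega> \<in> configs n. \<sigma> \<subseteq> snd \<omega> ` {..<?k}} \<and> R j \<omega>. config_weight n \<omega>)"
  proof (rule sum_le_sum_cover)
    show "finite {\<omega> \<in> configs n. \<sigma> \<subseteq> snd \<omega> ` {..<?k}}" using finite_configs by simp
    fix \<omega> assume "\<omega> \<in> {\<omega> \<in> configs n. \<sigma> \<subseteq> snd \<omega> ` {..<?k}}"
    then obtain v e where \<omega>: "\<omega> = (v, e)" "(v, e) \<in> configs n" "\<sigma> \<subseteq> e ` {..<?k}"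
      by (cases \<omega>) auto
    define I where "I = {i. i < ?k \<and> e i \<in> \<sigma>}"
    define a where "a = (\<lambda>i\<in>{..<?k}. if e i \<in> \<sigma> then e i else d)"
    have "e ` I = \<sigma>" using \<omega>(3) unfolding I_def by auto
    moreover have "inj_on e I" using config_edges_inj[OF \<omega>(2)] unfolding I_def by (rule inj_on_subset) auto
    ultimately have "card I = card \<sigma>" using card_image by fastforce
    hence "(I, a) \<in> J" unfolding J_def I_def a_def using d by auto
    moreover have "R (I, a) \<omega>" unfolding R_def I_def a_def \<omega>(1) by auto
    ultimately show "\<exists>j\<in>J. R j \<omega>" by blast
  qed (use finJ config_weight_nonneg in auto)
  also have "\<dots> \<le> (\<Sum>j\<in>J. Z)" by (rule sum_mono) (rule each)
  also have "\<dots> = real (card J) * Z" by simp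
  also have "\<dots> \<le> real (2 ^ ?k * ?k ^ ?k) * Z" using cardJ Z0 by (intro mult_right_mono of_nat_mono)
  also have "\<dots> = 2 ^ ?k * real ?k ^ ?k * real r ^ ?k / (t ^ min (card \<sigma> - 1) n * (t * N) ^ (card \<sigma> - 1))"
    unfolding Z_def by (simp only: of_nat_mult of_nat_power of_nat_numeral times_divide_eq_right)
  finally show ?thesis by simp
qed

end

section \<open>From the weights to the balanced family of cycles\<close>

theorem theorem3p1:
  fixes r k :: nat
  assumes "3 \<le> r" and "3 \<le> k"
  shows "\<exists>K::real. K > 0 \<and>
    (\<forall>(n::nat) (G::nat hypergraph) (t::real).
       1 \<le> n \<longrightarrow> r_graph r G \<longrightarrow> verts G = {1..n} \<longrightarrow>
       real (card (edges G)) = t * real n ^ (r - 1) \<longrightarrow>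
       2 * real k * (real r - 1) \<le> t \<longrightarrow>
       (let D = (if 4 \<le> r then t ^ 2 * real n ^ (r - 4) else t) in
        \<exists>H::nat set hypergraph.
          r_graph k H \<and> verts H = edges G \<and>
          (\<forall>S\<in>edges H. \<exists>C. copy_in C (linear_cycle r k) G \<and> edges C = S) \<and>
          average_degree k H \<ge> inverse K * t ^ (k - 2) * D ^ (k - 1) \<and>
          (\<forall>j. 1 \<le> j \<and> j \<le> k - 1 \<longrightarrow>
             real (max_degree j H) \<le> K * t ^ (k - j - 1) * D ^ (k - j))))"
proof -
  define m where "m = k - 2"
  have km: "k = m + 2" unfolding m_def using assms(2) by simp
  \<comment> \<open>The division by 2 in \<open>c\<close> pays for passing to half of the edges;
    \<open>C\<close> is the constant of \<open>configs_marginal_le\<close>.\<close>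
  define c C :: real where "c = (1/2) ^ (2 * m + 2) / 2" and "C = 2 ^ k * real k ^ k * real r ^ k"
  define K :: real where "K = max 1 (C * (1 + 2 ^ (k + 1)) / c)"
  have c: "0 < c" unfolding c_def by simp
  have C: "0 < C" unfolding C_def using assms by simp
  have K1: "1 \<le> K" unfolding K_def by simp
  have "C * (1 + 2 ^ (k + 1)) / c \<le> K" unfolding K_def by simp
  hence KC: "C * (1 + 2 ^ (k + 1)) \<le> K * c" using c by (simp add: pos_divide_le_eq)
  show ?thesis
  proof (intro exI[of _ K] conjI allI impI)
    show "0 < K" using K1 by simp
  next
    fix n :: nat and G :: "nat hypergraph" and t :: real
    assume n: "1 \<le> n" and G: "r_graph r G" and V: "verts G = {1..n}"
      and cardE: "real (card (edges G)) = t * real n ^ (r - 1)"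
      and t: "2 * real k * (real r - 1) \<le> t"
    define D where "D = (if 4 \<le> r then t ^ 2 * real n ^ (r - 4) else t)"
    define N where "N = real n ^ (r - 3)"
    let ?E = "edges G"
    have edgeG: "e \<subseteq> {1..n} \<and> card e = r" if "e \<in> ?E" for e
      using G that V unfolding r_graph_def by auto
    have finE: "finite ?E" using G unfolding r_graph_def by simp
    have N: "0 < N" unfolding N_def using n by simp
    have "real k = real k * 1" by simp
    also have "\<dots> \<le> 2 * real k * (real r - 1)" using assms by (intro mult_mono) auto
    finally have kt: "real k \<le> t" using t by simp
    hence t1: "1 \<le> t" and t0: "0 < t" using assms(2) by auto
    \<comment> \<open>There are at most \<open>n ^ r\<close> edges.\<close>
    have tn: "t \<le> real n"
    proof -
      have "card ?E \<le> card {e. e \<subseteq> {1..n} \<and> card e = r}"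
        using edgeG by (intro card_mono) auto
      also have "\<dots> \<le> n ^ r" by (simp add: n_subsets binomial_le_power)
      finally have "real (card ?E) \<le> real (n ^ r)" by (rule of_nat_mono)
      also have "n ^ r = n * n ^ (r - 1)" using assms(1) by (cases r) auto
      finally show ?thesis unfolding cardE using n by simp
    qed
    have D1: "1 \<le> D"
    proof (cases "4 \<le> r")
      case True
      have "1 * 1 \<le> t ^ 2 * real n ^ (r - 4)" using t1 n by (intro mult_mono) auto
      thus ?thesis unfolding D_def using True by simp
    next
      case False
      thus ?thesis unfolding D_def using t1 by simp
    qed
    \<comment> \<open>For \<open>r = 3\<close> both sides equal \<open>t\<close>; for larger
      \<open>r\<close> one factor \<open>t\<close> of \<open>D\<close> is traded for
      \<open>n\<close>.\<close>
    have DN: "D \<le> t * N"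
    proof (cases "4 \<le> r")
      case True
      hence "r - 3 = Suc (r - 4)" by simp
      hence "N = real n * real n ^ (r - 4)" unfolding N_def by simp
      moreover have "t * (t * real n ^ (r - 4)) \<le> t * (real n * real n ^ (r - 4))"
        using t0 tn by (intro mult_left_mono mult_right_mono) auto
      ultimately show ?thesis unfolding D_def using True by (simp add: power2_eq_square mult.assoc)
    next
      case False
      thus ?thesis unfolding D_def N_def using assms(1) by simp
    qed
    obtain F where FE: "F \<subseteq> ?E"
      and cardF: "real (card ?E) - t * N * real (card {1..n} choose 2) \<le> real (card F)"
      and core: "\<And>a b. pair_degree F a b = 0 \<or> t * N \<le> pair_degree F a b"
      using exists_dense_pair_core[of "{1..n}" ?E "t * N"] edgeG t0 N by auto
    \<comment> \<open>With threshold \<open>t * N\<close>, the loss is at most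
      \<open>t * N * n ^ 2 / 2\<close>, half of the edges.\<close>
    have half: "real (card ?E) / 2 \<le> real (card F)"
    proof -
      have "2 * (n choose 2) \<le> n ^ 2" using binomial_fact_pow[of n 2] by (simp add: mult.commute)
      hence "2 * real (n choose 2) \<le> real n ^ 2" by (metis of_nat_le_iff of_nat_mult of_nat_numeral of_nat_power)
      hence "t * N * (2 * real (n choose 2)) \<le> t * N * real n ^ 2"
        using t0 N by (intro mult_left_mono) auto
      also have "\<dots> = real (card ?E)"
      proof -
        have "r - 1 = (r - 3) + 2" using assms(1) by simp
        thus ?thesis unfolding cardE N_def by (simp add: power_add power2_eq_square)
      qed
      finally show ?thesis using cardF by simp
    qed
    have edgeF: "e \<subseteq> {1..n} \<and> card e = r" if "e \<in> F" for e
      using edgeG FE that by blast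
    interpret dense_pairs "{1..n}" F r N t
    proof
      show "triple_degree F a b d \<le> N" for a b d
        using triple_degree_le[of "{1..n}" F r a b d, OF finite_atLeastAtMost edgeF]
        unfolding N_def by simp
      show "e \<subseteq> {1..n} \<and> card e = r" if "e \<in> F" for e using edgeF[OF that] .
    qed (use assms N t0 core in auto)
    define \<phi> where "\<phi> \<omega> = snd \<omega> ` {..<k}" for \<omega> :: "(nat \<Rightarrow> nat) \<times> (nat \<Rightarrow> nat set)"
    have cfg: "\<phi> \<omega> \<subseteq> F \<and> card (\<phi> \<omega>) = k" if "\<omega> \<in> configs m" for \<omega>
    proof -
      obtain v e where \<omega>: "\<omega> = (v, e)" by fastforce
      have "inj_on e {..<k}" using config_edges_inj[of v e m] that unfolding \<omega> km by simp
      moreover have "e ` {..<k} \<subseteq> F" using that unfolding \<omega> configs_def km by auto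
      ultimately show ?thesis unfolding \<phi>_def \<omega> by (simp add: card_image)
    qed
    have marg: "(\<Sum>\<omega> | \<omega> \<in> configs m \<and> \<sigma> \<subseteq> \<phi> \<omega>. config_weight m \<omega>)
        \<le> C / (t ^ min (card \<sigma> - 1) m * (t * N) ^ (card \<sigma> - 1))"
      if \<sigma>: "1 \<le> card \<sigma>" "card \<sigma> \<le> k" for \<sigma>
    proof (cases "\<sigma> \<subseteq> F")
      case True
      show ?thesis using configs_marginal_le[OF t1 True \<sigma>(1), of m] \<sigma>(2)
        unfolding C_def \<phi>_def km by simp
    next
      case False
      hence none: "{\<omega>. \<omega> \<in> configs m \<and> \<sigma> \<subseteq> \<phi> \<omega>} = {}" using cfg by blast
      show ?thesis unfolding none using C t0 N by simp
    qed
    have "\<exists>H\<subseteq>\<phi> ` configs m. inverse K * (t * D) ^ (k - 2) * D \<le> real k * card H / card ?E \<and>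
      (\<forall>\<sigma>\<subseteq>?E. 1 \<le> card \<sigma> \<and> card \<sigma> \<le> k - 1 \<longrightarrow>
         real (card {S \<in> H. \<sigma> \<subseteq> S}) \<le> K * (t * D) ^ (k - 1 - card \<sigma>) * D)"
    proof (rule balanced_subfamily_of_spread_weight[where \<mu> = "config_weight m" and C = C and c = c])
      show "?E \<noteq> {}" using cardE t0 n by auto
      show "\<phi> \<omega> \<subseteq> ?E \<and> card (\<phi> \<omega>) = k" if "\<omega> \<in> configs m" for \<omega>
        using cfg[OF that] FE by auto
      show "2 \<le> k" using assms(2) by simp
      show "1 \<le> t * D" using mult_mono[of 1 t 1 D] t1 D1 by simp
      show "c * real (card ?E) \<le> (\<Sum>\<omega>\<in>configs m. config_weight m \<omega>)"
      proof -
        have "c * real (card ?E) = (1/2) ^ (2 * m + 2) * (real (card ?E) / 2)" unfolding c_def by simp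
        also have "\<dots> \<le> (1/2) ^ (2 * m + 2) * real (card F)" using half by (intro mult_left_mono) auto
        also have "\<dots> \<le> (\<Sum>\<omega>\<in>configs m. config_weight m \<omega>)"
          using t unfolding km by (rule configs_total_weight_ge)
        finally show ?thesis .
      qed
      show "(\<Sum>\<omega> | \<omega> \<in> configs m \<and> \<sigma> \<subseteq> \<phi> \<omega>. config_weight m \<omega>) \<le> C / (t * D) ^ (card \<sigma> - 1)"
        if \<sigma>: "\<sigma> \<subseteq> ?E" "1 \<le> card \<sigma>" "card \<sigma> \<le> k - 1" for \<sigma>
      proof -
        \<comment> \<open>Below size \<open>k\<close> every further edge brings a new vertex, so it
          costs \<open>t * (t * N)\<close>, at least \<open>t * D\<close>.\<close>
        have mi: "min (card \<sigma> - 1) m = card \<sigma> - 1" using \<sigma>(3) unfolding km by simp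
        have "(t * D) ^ (card \<sigma> - 1) \<le> (t * (t * N)) ^ (card \<sigma> - 1)"
          using t0 D1 DN by (intro power_mono mult_left_mono) auto
        also have "\<dots> = t ^ (card \<sigma> - 1) * (t * N) ^ (card \<sigma> - 1)" by (rule power_mult_distrib)
        finally have "C / (t ^ (card \<sigma> - 1) * (t * N) ^ (card \<sigma> - 1)) \<le> C / (t * D) ^ (card \<sigma> - 1)"
          using C t0 D1 by (intro frac_le) auto
        thus ?thesis using marg[of \<sigma>] \<sigma> unfolding mi by linarith
      qed
      show "(\<Sum>\<omega> | \<omega> \<in> configs m \<and> S \<subseteq> \<phi> \<omega>. config_weight m \<omega>) \<le> C / ((t * D) ^ (k - 2) * D)"
        if S: "S \<subseteq> ?E" "card S = k" for S
      proof -
        \<comment> \<open>The edge closing the cycle saves only \<open>t * N\<close>; this is the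
          lone factor \<open>D\<close> next to \<open>(t * D) ^ (k - 2)\<close>.\<close>
        have mi: "min (card S - 1) m = m" "card S - 1 = Suc m" using S(2) unfolding km by auto
        have "(t * D) ^ (k - 2) * D = t ^ m * D ^ Suc m" unfolding km by (simp add: power_mult_distrib)
        also have "\<dots> \<le> t ^ m * (t * N) ^ Suc m"
          using t0 D1 DN by (intro mult_left_mono power_mono) auto
        finally have "C / (t ^ m * (t * N) ^ Suc m) \<le> C / ((t * D) ^ (k - 2) * D)"
          using C t0 D1 by (intro frac_le) auto
        thus ?thesis using marg[of S] S assms(2) unfolding mi by linarith
      qed
    qed (use finE finite_configs D1 C K1 KC config_weight_nonneg in auto)
    then obtain H where H: "H \<subseteq> \<phi> ` configs m"
      and avg: "inverse K * (t * D) ^ (k - 2) * D \<le> real k * card H / card ?E"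
      and deg: "\<And>\<sigma>. \<sigma> \<subseteq> ?E \<Longrightarrow> 1 \<le> card \<sigma> \<Longrightarrow> card \<sigma> \<le> k - 1 \<Longrightarrow>
         real (card {S \<in> H. \<sigma> \<subseteq> S}) \<le> K * (t * D) ^ (k - 1 - card \<sigma>) * D"
      by blast
    have "r_graph k (?E, H)"
    proof -
      have "finite H" using H finite_configs finite_subset by blast
      moreover have "S \<subseteq> ?E \<and> card S = k" if "S \<in> H" for S using that H cfg FE by blast
      ultimately show ?thesis unfolding r_graph_def using finE by simp
    qed
    moreover have "\<exists>X. copy_in X (linear_cycle r k) G \<and> edges X = S" if "S \<in> H" for S
    proof -
      have "S \<in> \<phi> ` configs m" using that H by blast
      then obtain v e where ve: "(v, e) \<in> configs m" "S = e ` {..<k}" unfolding \<phi>_def by force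
      have "copy_in (\<Union>i<k. e i, e ` {..<k}) (linear_cycle r k) (verts G, ?E)"
      proof (rule linear_cycle_copy)
        show "2 \<le> k" using assms by simp
        show "inj_on v {..<k}" "cycle_config k k v e" using ve(1) unfolding configs_def km by auto
        have "e i \<in> F" if "i < k" for i using ve(1) that unfolding configs_def km by auto
        thus "e i \<in> ?E \<and> e i \<subseteq> verts G \<and> card (e i) = r" if "i < k" for i
          using that edgeG FE V by auto
      qed (rule assms)
      thus ?thesis using ve(2) by auto
    qed
    moreover have "inverse K * t ^ (k - 2) * D ^ (k - 1) \<le> average_degree k (?E, H)"
    proof -
      have "k - 1 = Suc (k - 2)" using assms by simp
      thus ?thesis using avg unfolding average_degree_def by (simp add: power_mult_distrib mult_ac)
    qed
    moreover have "real (max_degree j (?E, H)) \<le> K * t ^ (k - j - 1) * D ^ (k - j)"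
      if j: "1 \<le> j" "j \<le> k - 1" for j
    proof -
      \<comment> \<open>\<open>Max\<close> is meaningful only on a nonempty set, so at least
        \<open>j\<close> edges must exist.\<close>
      have "real k \<le> t * 1" using kt by simp
      also have "\<dots> \<le> t * real n ^ (r - 1)" using t0 n by (intro mult_left_mono) auto
      finally have "k \<le> card ?E" unfolding cardE[symmetric] by simp
      hence "j \<le> card ?E" using j by linarith
      then obtain \<sigma>0 where "\<sigma>0 \<subseteq> ?E" "card \<sigma>0 = j" by (meson obtain_subset_with_card_n)
      hence "{\<sigma>. \<sigma> \<subseteq> ?E \<and> card \<sigma> = j} \<noteq> {}" by blast
      hence "max_degree j (?E, H) \<in> degree (?E, H) ` {\<sigma>. \<sigma> \<subseteq> ?E \<and> card \<sigma> = j}"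
        unfolding max_degree_def fst_conv using finE by (intro Max_in) auto
      then obtain \<sigma> where \<sigma>: "\<sigma> \<subseteq> ?E" "card \<sigma> = j" "max_degree j (?E, H) = degree (?E, H) \<sigma>" by blast
      have "real (max_degree j (?E, H)) \<le> K * (t * D) ^ (k - 1 - j) * D"
        using deg[OF \<sigma>(1)] j \<sigma>(2) unfolding \<sigma>(3) degree_def by simp
      also have "\<dots> = K * t ^ (k - j - 1) * D ^ (k - j)"
      proof -
        have "k - j = Suc (k - 1 - j)" "k - j - 1 = k - 1 - j" using j by auto
        thus ?thesis by (simp add: power_mult_distrib mult_ac)
      qed
      finally show ?thesis .
    qed
    ultimately have "\<exists>H::nat set hypergraph.
          r_graph k H \<and> verts H = edges G \<and>
          (\<forall>S\<in>edges H. \<exists>C. copy_in C (linear_cycle r k) G \<and> edges C = S) \<and>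
          average_degree k H \<ge> inverse K * t ^ (k - 2) * D ^ (k - 1) \<and>
          (\<forall>j. 1 \<le> j \<and> j \<le> k - 1 \<longrightarrow>
             real (max_degree j H) \<le> K * t ^ (k - j - 1) * D ^ (k - j))"
      by (intro exI[of _ "(?E, H)"]) simp
    thus "let D = (if 4 \<le> r then t ^ 2 * real n ^ (r - 4) else t) in
        \<exists>H::nat set hypergraph.
          r_graph k H \<and> verts H = edges G \<and>
          (\<forall>S\<in>edges H. \<exists>C. copy_in C (linear_cycle r k) G \<and> edges C = S) \<and>
          average_degree k H \<ge> inverse K * t ^ (k - 2) * D ^ (k - 1) \<and>
          (\<forall>j. 1 \<le> j \<and> j \<le> k - 1 \<longrightarrow>
             real (max_degree j H) \<le> K * t ^ (k - j - 1) * D ^ (k - j))"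
      unfolding Let_def D_def .
  qed
qed

end
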